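(* Let $(\tilde M^{n+p},\tilde F)$ be a Randers manifold with navigation data $(\tilde h,\tilde W)$ and let $f:M^n\to(\tilde M^{n+p},\tilde F)$ be a submanifold isometrically immersed (i.e. $M$ carries the induced Randers metric $F=f^*\tilde F$), locally given by $\tilde x^\alpha=f^\alpha(x^1,\dots,x^n)$. Then the BH-mean curvature form (resp. the HT-mean curvature form) $\mathcal H_f=\mathcal H_\gamma\,d\tilde x^\gamma$ of $f$ is given by \begin{align*} \mathcal H_\gamma={}&\frac{2(\log\chi)'}{\varrho}\Big[2\varrho' B^{\eta\delta}\tilde W_\delta\tilde W_\tau(\delta^\tau_\gamma-B^\tau_\gamma)-\varrho(\delta^\eta_\gamma-B^\eta_\gamma)\Big]\tilde W_{\alpha|\eta}\tilde W^\alpha\\ &-\frac1{\varrho}\Big\{2\varrho'\Big[(\tilde h^{\alpha\beta}-B^{\alpha\beta})(\delta^\eta_\gamma-B^\eta_\gamma)+B^{\eta\alpha}(\delta^\beta_\gamma-B^\beta_\gamma)\Big]\\ &\qquad-2B^{\eta\beta}\Big[2\varrho''(\tilde h^{\alpha\delta}-B^{\alpha\delta})\tilde W_\delta\tilde W_\tau(\delta^\tau_\gamma-B^\tau_\gamma)-\varrho'(\delta^\alpha_\gamma-B^\alpha_\gamma)\Big]\Big\}\tilde W_{\alpha|\eta}\tilde W_\beta\\ &-\frac1{\varrho}\Big\{h^{ij}\Big[2\varrho'\tilde W_\alpha\tilde W_\beta(\delta^\alpha_\eta-B^\alpha_\eta)(\delta^\beta_\gamma-B^\beta_\gamma)+\varrho(\tilde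 h_{\gamma\eta}-B_{\gamma\eta})\Big]\\ &\qquad+2\tilde W_\delta\tilde W_\tau A^{i\delta}A^{j\tau}\Big[2\varrho''\tilde W_\alpha\tilde W_\beta(\delta^\alpha_\eta-B^\alpha_\eta)(\delta^\beta_\gamma-B^\beta_\gamma)-\varrho'(\tilde h_{\gamma\eta}-B_{\gamma\eta})\Big]\Big\}\tau^\eta_{ij}. \end{align*}
   Context: Navigation data: $\tilde h$ is a Riemannian metric on $\tilde M$ and $\tilde W$ a vector field with $\|\tilde W\|_{\tilde h}<1$; the Randers metric is $\tilde F(\tilde x,y)=\big(\sqrt{\lambda\,\tilde h(y,y)+\tilde h(\tilde W,y)^2}-\tilde h(\tilde W,y)\big)/\lambda$ with $\lambda=1-\|\tilde W\|^2_{\tilde h}$. Index ranges $1\le i,j,k\le n$, $1\le\alpha,\beta,\gamma,\eta,\delta,\tau\le n+p$, with summation convention. Notation: $z^\alpha_i=\partial f^\alpha/\partial x^i$, $\tilde W_\alpha=\tilde h_{\alpha\beta}\tilde W^\beta$, $h_{ij}=\tilde h_{\alpha\beta}z^\alpha_iz^\beta_j$, $(h^{ij})=(h_{ij})^{-1}$, $W_i=\tilde W_\alpha z^\alpha_i$, $\|W\|^2_h=h^{ij}W_iW_j$, $\mathfrak s=1-\|\tilde W\|^2_{\tilde h}+\|W\|^2_h$, $A^{i\alpha}=h^{ij}z^\alpha_j$, $B^{\alpha\beta}=h^{ij}z^\alpha_iz^\beta_j$, $B^\alpha_\beta=B^{\alpha\delta}\tilde h_{\delta\beta}$, $B_{\gamma\eta}=\tilde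 h_{\gamma\alpha}B^\alpha_\eta$. $\tilde W^\beta_{|\eta}$ are the components of $\nabla^{\tilde h}\tilde W$ (Levi-Civita connection of $\tilde h$), $\tilde W_{\alpha|\eta}=\tilde h_{\alpha\beta}\tilde W^\beta_{|\eta}$. $\tau^\alpha_{ij}=\frac{\partial^2f^\alpha}{\partial x^i\partial x^j}+\tilde\Gamma^\alpha_{\tau\delta}z^\tau_jz^\delta_i-\Gamma^k_{ij}z^\alpha_k$ are the coefficients of the second fundamental form of $f:(M,h)\to(\tilde M,\tilde h)$, where $\Gamma,\tilde\Gamma$ are Christoffel symbols of $h,\tilde h$. Volume data: $(\varrho,\chi)=(\mathfrak s^{-n/2},1)$ in the Busemann–Hausdorff (BH) case and $(\varrho,\chi)=(\mathfrak s^{1/2},(1-\|\tilde W\|^2_{\tilde h})^{(n+1)/2})$ in the Holmes–Thompson (HT) case; $\varrho',\varrho''$ are derivatives in $\mathfrak s$, $\chi$ is viewed as a function of $\|\tilde W\|^2_{\tilde h}$ and $(\log\chi)'$ is the derivative with respect to $\|\tilde W\|^2_{\tilde h}$. The induced volume form is $dV_F=\mathcal F(\tilde x,z)\,dx^1\wedge\dots\wedge dx^n$ with $\mathcal F=\frac{\varrho(\mathfrak s)}{\chi}\sqrt{\det(h_{ij})}$, regarded as a function of $\tilde x$ and $z=(z^\alpha_i)$. The mean curvature form $\mathcal H_f=\mathcal H_\gamma d\tilde x^\gamma$ is defined by $\mathcal H_\gamma=\frac1{\mathcal F}\Big\{\frac{\partial\mathcal F}{\partial\tilde x^\gamma}-\frac{\partial^2\mathcal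 F}{\partial z^\gamma_i\partial z^\eta_j}\frac{\partial^2 f^\eta}{\partial x^i\partial x^j}-\frac{\partial^2\mathcal F}{\partial\tilde x^\eta\partial z^\gamma_i}\frac{\partial f^\eta}{\partial x^i}\Big\}$ (BH- or HT-mean curvature form according to the choice of $(\varrho,\chi)$). *)

theory Defs
  imports "HOL-Analysis.Analysis"
begin

text \<open>Local-coordinate setting. M carries coordinates x = (x^i), i :: 'n (n = CARD('n));
  the ambient manifold carries coordinates xt = (xt^alpha), alpha :: 'm (n+p = CARD('m)).
  A point z = (z^alpha_i) is encoded as z :: real^'m^'n with z $ i $ alpha = z^alpha_i.\<close>

definition kron :: "'a \<Rightarrow> 'a \<Rightarrow> real" where
  "kron a b = (if a = b then 1 else 0)"

definition pd :: "(real^'k \<Rightarrow> real) \<Rightarrow> 'k \<Rightarrow> real^'k \<Rightarrow> real" where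
  "pd g k x = deriv (\<lambda>t. g (x + t *\<^sub>R axis k 1)) 0"

fun Ck_on :: "nat \<Rightarrow> (real^'k) set \<Rightarrow> (real^'k \<Rightarrow> real) \<Rightarrow> bool" where
  "Ck_on 0 U g = continuous_on U g"
| "Ck_on (Suc k) U g = (g differentiable_on U \<and> (\<forall>i. Ck_on k U (pd g i)))"

definition smooth_on :: "(real^'k) set \<Rightarrow> (real^'k \<Rightarrow> real) \<Rightarrow> bool" where
  "smooth_on U g = (\<forall>k. Ck_on k U g)"

definition pdx :: "(real^'m \<Rightarrow> real^'m^'n \<Rightarrow> real) \<Rightarrow> 'm \<Rightarrow> real^'m \<Rightarrow> real^'m^'n \<Rightarrow> real" where
  "pdx F eta xt z = deriv (\<lambda>t. F (xt + t *\<^sub>R axis eta 1) z) 0"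

definition pdz :: "(real^'m \<Rightarrow> real^'m^'n \<Rightarrow> real) \<Rightarrow> 'm \<Rightarrow> 'n \<Rightarrow> real^'m \<Rightarrow> real^'m^'n \<Rightarrow> real" where
  "pdz F gam i xt z = deriv (\<lambda>t. F xt (z + t *\<^sub>R axis i (axis gam 1))) 0"

text \<open>Volume data: Busemann-Hausdorff or Holmes-Thompson.\<close>
datatype volume_kind = BH | HT

definition rho :: "volume_kind \<Rightarrow> nat \<Rightarrow> real \<Rightarrow> real" where
  "rho v n s = (case v of BH \<Rightarrow> s powr (- real n / 2) | HT \<Rightarrow> s powr (1/2))"

definition chi :: "volume_kind \<Rightarrow> nat \<Rightarrow> real \<Rightarrow> real" where
  "chi v n w = (case v of BH \<Rightarrow> 1 | HT \<Rightarrow> (1 - w) powr ((real n + 1) / 2))"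

text \<open>Navigation data: ht xt = (h-tilde_{alpha beta}(xt)), Wt xt = (W-tilde^alpha(xt)).\<close>

definition Wtlow :: "(real^'m \<Rightarrow> real^'m^'m) \<Rightarrow> (real^'m \<Rightarrow> real^'m) \<Rightarrow> real^'m \<Rightarrow> 'm \<Rightarrow> real" where
  "Wtlow ht Wt xt a = (\<Sum>b\<in>UNIV. ht xt $ a $ b * Wt xt $ b)"

definition normWt2 :: "(real^'m \<Rightarrow> real^'m^'m) \<Rightarrow> (real^'m \<Rightarrow> real^'m) \<Rightarrow> real^'m \<Rightarrow> real" where
  "normWt2 ht Wt xt = (\<Sum>a\<in>UNIV. \<Sum>b\<in>UNIV. ht xt $ a $ b * Wt xt $ a * Wt xt $ b)"

definition hmat :: "(real^'m \<Rightarrow> real^'m^'m) \<Rightarrow> real^'m \<Rightarrow> real^'m^'n \<Rightarrow> real^'n^'n" where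
  "hmat ht xt z = (\<chi> i j. \<Sum>a\<in>UNIV. \<Sum>b\<in>UNIV. ht xt $ a $ b * z $ i $ a * z $ j $ b)"

definition hinv :: "(real^'m \<Rightarrow> real^'m^'m) \<Rightarrow> real^'m \<Rightarrow> real^'m^'n \<Rightarrow> real^'n^'n" where
  "hinv ht xt z = matrix_inv (hmat ht xt z)"

definition Wlow :: "(real^'m \<Rightarrow> real^'m^'m) \<Rightarrow> (real^'m \<Rightarrow> real^'m) \<Rightarrow> real^'m \<Rightarrow> real^'m^'n \<Rightarrow> 'n \<Rightarrow> real" where
  "Wlow ht Wt xt z i = (\<Sum>a\<in>UNIV. Wtlow ht Wt xt a * z $ i $ a)"

definition normW2 :: "(real^'m \<Rightarrow> real^'m^'m) \<Rightarrow> (real^'m \<Rightarrow> real^'m) \<Rightarrow> real^'m \<Rightarrow> real^'m^'n \<Rightarrow> real" where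
  "normW2 ht Wt xt z = (\<Sum>i\<in>UNIV. \<Sum>j\<in>UNIV. hinv ht xt z $ i $ j * Wlow ht Wt xt z i * Wlow ht Wt xt z j)"

definition sfun :: "(real^'m \<Rightarrow> real^'m^'m) \<Rightarrow> (real^'m \<Rightarrow> real^'m) \<Rightarrow> real^'m \<Rightarrow> real^'m^'n \<Rightarrow> real" where
  "sfun ht Wt xt z = 1 - normWt2 ht Wt xt + normW2 ht Wt xt z"

definition volF :: "volume_kind \<Rightarrow> (real^'m \<Rightarrow> real^'m^'m) \<Rightarrow> (real^'m \<Rightarrow> real^'m) \<Rightarrow> real^'m \<Rightarrow> real^'m^'n \<Rightarrow> real" where
  "volF v ht Wt xt z =
     rho v CARD('n) (sfun ht Wt xt z) / chi v CARD('n) (normWt2 ht Wt xt) * sqrt (det (hmat ht xt z))"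

definition Amat :: "(real^'m \<Rightarrow> real^'m^'m) \<Rightarrow> real^'m \<Rightarrow> real^'m^'n \<Rightarrow> 'n \<Rightarrow> 'm \<Rightarrow> real" where
  "Amat ht xt z i a = (\<Sum>j\<in>UNIV. hinv ht xt z $ i $ j * z $ j $ a)"

definition Bup :: "(real^'m \<Rightarrow> real^'m^'m) \<Rightarrow> real^'m \<Rightarrow> real^'m^'n \<Rightarrow> 'm \<Rightarrow> 'm \<Rightarrow> real" where
  "Bup ht xt z a b = (\<Sum>i\<in>UNIV. \<Sum>j\<in>UNIV. hinv ht xt z $ i $ j * z $ i $ a * z $ j $ b)"

definition Bmix :: "(real^'m \<Rightarrow> real^'m^'m) \<Rightarrow> real^'m \<Rightarrow> real^'m^'n \<Rightarrow> 'm \<Rightarrow> 'm \<Rightarrow> real" where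
  "Bmix ht xt z a b = (\<Sum>d\<in>UNIV. Bup ht xt z a d * ht xt $ d $ b)"

definition Blow :: "(real^'m \<Rightarrow> real^'m^'m) \<Rightarrow> real^'m \<Rightarrow> real^'m^'n \<Rightarrow> 'm \<Rightarrow> 'm \<Rightarrow> real" where
  "Blow ht xt z c e = (\<Sum>a\<in>UNIV. ht xt $ c $ a * Bmix ht xt z a e)"

definition Gt :: "(real^'m \<Rightarrow> real^'m^'m) \<Rightarrow> real^'m \<Rightarrow> 'm \<Rightarrow> 'm \<Rightarrow> 'm \<Rightarrow> real" where
  "Gt ht xt a t d = (1/2) * (\<Sum>b\<in>UNIV. matrix_inv (ht xt) $ a $ b *
      (pd (\<lambda>y. ht y $ b $ d) t xt + pd (\<lambda>y. ht y $ b $ t) d xt - pd (\<lambda>y. ht y $ t $ d) b xt))"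

definition Wcov :: "(real^'m \<Rightarrow> real^'m^'m) \<Rightarrow> (real^'m \<Rightarrow> real^'m) \<Rightarrow> real^'m \<Rightarrow> 'm \<Rightarrow> 'm \<Rightarrow> real" where
  "Wcov ht Wt xt b e = pd (\<lambda>y. Wt y $ b) e xt + (\<Sum>d\<in>UNIV. Gt ht xt b e d * Wt xt $ d)"

definition Wcovlow :: "(real^'m \<Rightarrow> real^'m^'m) \<Rightarrow> (real^'m \<Rightarrow> real^'m) \<Rightarrow> real^'m \<Rightarrow> 'm \<Rightarrow> 'm \<Rightarrow> real" where
  "Wcovlow ht Wt xt a e = (\<Sum>b\<in>UNIV. ht xt $ a $ b * Wcov ht Wt xt b e)"

definition jac :: "(real^'n \<Rightarrow> real^'m) \<Rightarrow> real^'n \<Rightarrow> real^'m^'n" where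
  "jac f x = (\<chi> i a. pd (\<lambda>y. f y $ a) i x)"

definition hM :: "(real^'m \<Rightarrow> real^'m^'m) \<Rightarrow> (real^'n \<Rightarrow> real^'m) \<Rightarrow> real^'n \<Rightarrow> real^'n^'n" where
  "hM ht f x = hmat ht (f x) (jac f x)"

definition GM :: "(real^'m \<Rightarrow> real^'m^'m) \<Rightarrow> (real^'n \<Rightarrow> real^'m) \<Rightarrow> real^'n \<Rightarrow> 'n \<Rightarrow> 'n \<Rightarrow> 'n \<Rightarrow> real" where
  "GM ht f x k i j = (1/2) * (\<Sum>l\<in>UNIV. matrix_inv (hM ht f x) $ k $ l *
      (pd (\<lambda>y. hM ht f y $ l $ j) i x + pd (\<lambda>y. hM ht f y $ l $ i) j x - pd (\<lambda>y. hM ht f y $ i $ j) l x))"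

definition sff :: "(real^'m \<Rightarrow> real^'m^'m) \<Rightarrow> (real^'n \<Rightarrow> real^'m) \<Rightarrow> real^'n \<Rightarrow> 'm \<Rightarrow> 'n \<Rightarrow> 'n \<Rightarrow> real" where
  "sff ht f x a i j =
     pd (pd (\<lambda>y. f y $ a) j) i x
     + (\<Sum>t\<in>UNIV. \<Sum>d\<in>UNIV. Gt ht (f x) a t d * jac f x $ j $ t * jac f x $ i $ d)
     - (\<Sum>k\<in>UNIV. GM ht f x k i j * jac f x $ k $ a)"

definition mean_curv :: "volume_kind \<Rightarrow> (real^'m \<Rightarrow> real^'m^'m) \<Rightarrow> (real^'m \<Rightarrow> real^'m) \<Rightarrow> (real^'n \<Rightarrow> real^'m) \<Rightarrow> real^'n \<Rightarrow> 'm \<Rightarrow> real" where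
  "mean_curv v ht Wt f x g =
     (let F = volF v ht Wt; xt = f x; z = jac f x in
      (1 / F xt z) *
      (pdx F g xt z
       - (\<Sum>e\<in>UNIV. \<Sum>i\<in>UNIV. \<Sum>j\<in>UNIV. pdz (pdz F e j) g i xt z * pd (pd (\<lambda>y. f y $ e) j) i x)
       - (\<Sum>e\<in>UNIV. \<Sum>i\<in>UNIV. pdx (pdz F g i) e xt z * jac f x $ i $ e)))"

definition H_formula :: "volume_kind \<Rightarrow> (real^'m \<Rightarrow> real^'m^'m) \<Rightarrow> (real^'m \<Rightarrow> real^'m) \<Rightarrow> (real^'n \<Rightarrow> real^'m) \<Rightarrow> real^'n \<Rightarrow> 'm \<Rightarrow> real" where
  "H_formula v ht Wt f x g =
    (let xt = f x; z = jac f x; n = CARD('n);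
         s = sfun ht Wt xt z; w = normWt2 ht Wt xt;
         r = rho v n s; r1 = deriv (rho v n) s; r2 = deriv (deriv (rho v n)) s;
         lc = deriv (\<lambda>u. ln (chi v n u)) w;
         Wu = (\<lambda>a. Wt xt $ a); Wl = Wtlow ht Wt xt; Wc = Wcovlow ht Wt xt;
         Hu = (\<lambda>a b. matrix_inv (ht xt) $ a $ b); Hl = (\<lambda>a b. ht xt $ a $ b);
         hi = (\<lambda>i j. hinv ht xt z $ i $ j);
         A = Amat ht xt z; BU = Bup ht xt z; BM = Bmix ht xt z; BL = Blow ht xt z;
         D = (\<lambda>a b. kron a b - BM a b);
         tau = sff ht f x
     in
       (2 * lc / r) * (\<Sum>e\<in>UNIV. \<Sum>a\<in>UNIV.
           (2 * r1 * (\<Sum>d\<in>UNIV. \<Sum>t\<in>UNIV. BU e d * Wl d * Wl t * D t g) - r * D e g)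
           * Wc a e * Wu a)
     - (1 / r) * (\<Sum>a\<in>UNIV. \<Sum>b\<in>UNIV. \<Sum>e\<in>UNIV.
           (2 * r1 * ((Hu a b - BU a b) * D e g + BU e a * D b g)
            - 2 * BU e b * (2 * r2 * (\<Sum>d\<in>UNIV. \<Sum>t\<in>UNIV. (Hu a d - BU a d) * Wl d * Wl t * D t g)
                            - r1 * D a g))
           * Wc a e * Wl b)
     - (1 / r) * (\<Sum>i\<in>UNIV. \<Sum>j\<in>UNIV. \<Sum>e\<in>UNIV.
           (hi i j * (2 * r1 * (\<Sum>a\<in>UNIV. \<Sum>b\<in>UNIV. Wl a * Wl b * D a e * D b g) + r * (Hl g e - BL g e))
            + 2 * (\<Sum>d\<in>UNIV. \<Sum>t\<in>UNIV. Wl d * Wl t * A i d * A j t)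
                * (2 * r2 * (\<Sum>a\<in>UNIV. \<Sum>b\<in>UNIV. Wl a * Wl b * D a e * D b g) - r1 * (Hl g e - BL g e)))
           * tau e i j))"

end

theory Submission
  imports Defs
begin

text \<open>Write \<open>H\<close> for the ambient metric, \<open>N\<close> for the inverse of the induced metric \<open>z H z\<^sup>T\<close>, \<open>q = N z H W\<close> for
  the tangential part of \<open>W\<close>, \<open>\<nu>\<close> for its normal part as a covector, \<open>A = N z H\<close>, and \<open>E\<close> for the metric
  on the normal space. Then \<open>\<partial>F/\<partial>z\<^sup>\<gamma>\<^sub>i = V (\<rho> A\<^sub>i\<^sub>\<gamma> + 2 \<rho>' q\<^sub>i \<nu>\<^sub>\<gamma>)\<close> with \<open>V = sqrt (det (z H z\<^sup>T)) / \<chi>\<close>. By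
  metric compatibility a partial derivative in an ambient coordinate \<open>e\<close> is an infinitesimal change
  of frame \<open>L = \<Gamma>\<^sub>e\<close> combined with the variation \<open>z L\<^sup>T\<close> of \<open>z\<close> and the covariant derivative \<open>W\<^sub>|\<^sub>e\<close> of \<open>W\<close>;
  the frame terms cancel in the Euler-Lagrange expression by torsion-freeness. Symmetrising the
  \<open>z\<close>-Hessian of \<open>F\<close> in \<open>(i, j)\<close> gives the coefficients of the second fundamental form, and the terms
  with \<open>W\<^sub>|\<^sub>e\<close> give the rest.\<close>

subsection \<open>Matrix calculus\<close>

text \<open>This simp rule would rewrite \<open>transpose M *v x\<close> to \<open>x v* M\<close>;
  here all products are kept in terms of \<open>**\<close>, \<open>*v\<close> and
  \<open>transpose\<close>.\<close>

declare transpose_matrix_vector [simp del]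

lemma bounded_bilinear_matrix_mult:
  "bounded_bilinear ((**) :: real^'b^'a \<Rightarrow> real^'c^'b \<Rightarrow> real^'c^'a)"
  unfolding bilinear_conv_bounded_bilinear[symmetric] bilinear_def
  by (auto intro!: linearI simp: vec_eq_iff matrix_matrix_mult_def algebra_simps sum.distrib sum_distrib_left)

lemma bounded_bilinear_matrix_vector_mult:
  "bounded_bilinear ((*v) :: real^'b^'a \<Rightarrow> real^'b \<Rightarrow> real^'a)"
  unfolding bilinear_conv_bounded_bilinear[symmetric] bilinear_def
  by (auto intro!: linearI simp: vec_eq_iff matrix_vector_mult_def algebra_simps sum.distrib sum_distrib_left)

lemma bounded_linear_transpose: "bounded_linear (transpose :: real^'b^'a \<Rightarrow> real^'a^'b)"
  unfolding linear_conv_bounded_linear[symmetric]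
  by (auto intro!: linearI simp: vec_eq_iff transpose_def)

text \<open>As rewrite rules these expand sums, associate products to the left, merge iterated
  \<open>*v\<close> into a single matrix and move \<open>transpose\<close> to the factors.
  Noncommutative identities then reduce to comparing monomials.\<close>

lemmas matrix_bilinear_simps =
  bounded_bilinear.add_left[OF bounded_bilinear_matrix_mult]
  bounded_bilinear.add_right[OF bounded_bilinear_matrix_mult]
  bounded_bilinear.diff_left[OF bounded_bilinear_matrix_mult]
  bounded_bilinear.diff_right[OF bounded_bilinear_matrix_mult]
  bounded_bilinear.minus_left[OF bounded_bilinear_matrix_mult]
  bounded_bilinear.minus_right[OF bounded_bilinear_matrix_mult]
  bounded_bilinear.add_left[OF bounded_bilinear_matrix_vector_mult]
  bounded_bilinear.add_right[OF bounded_bilinear_matrix_vector_mult]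
  bounded_bilinear.diff_left[OF bounded_bilinear_matrix_vector_mult]
  bounded_bilinear.diff_right[OF bounded_bilinear_matrix_vector_mult]
  bounded_bilinear.minus_left[OF bounded_bilinear_matrix_vector_mult]
  bounded_bilinear.minus_right[OF bounded_bilinear_matrix_vector_mult]
  linear_add[OF bounded_linear.linear[OF bounded_linear_transpose]]
  linear_diff[OF bounded_linear.linear[OF bounded_linear_transpose]]
  linear_neg[OF bounded_linear.linear[OF bounded_linear_transpose]]
  matrix_mul_assoc matrix_vector_mul_assoc matrix_transpose_mul

lemmas has_vector_derivative_matrix_mult =
  bounded_bilinear.has_vector_derivative[OF bounded_bilinear_matrix_mult]
lemmas has_vector_derivative_matrix_vector_mult =
  bounded_bilinear.has_vector_derivative[OF bounded_bilinear_matrix_vector_mult]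
lemmas has_vector_derivative_transpose =
  bounded_linear.has_vector_derivative[OF bounded_linear_transpose]

lemma has_vector_derivative_vec_nth:
  assumes "(f has_vector_derivative f') F"
  shows "((\<lambda>t. f t $ i) has_vector_derivative f' $ i) F"
  by (rule bounded_linear.has_vector_derivative[OF bounded_linear_vec_nth assms])

text \<open>The entries lie in an arbitrary Euclidean space, so that applying the rule twice covers
  matrices, which are vectors of rows.\<close>

lemma has_vector_derivative_vecI:
  fixes f :: "real \<Rightarrow> ('a::euclidean_space)^'k"
  assumes "\<And>i. ((\<lambda>t. f t $ i) has_vector_derivative f' $ i) (at t)"
  shows "(f has_vector_derivative f') (at t)"
  unfolding has_vector_derivative_def
proof (subst has_derivative_componentwise_within, rule ballI)
  fix b :: "'a^'k" assume "b \<in> Basis"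
  then obtain i u where b: "b = axis i u" "u \<in> Basis"
    by (auto simp: Basis_vec_def)
  have "((\<lambda>t. f t $ i \<bullet> u) has_vector_derivative f' $ i \<bullet> u) (at t)"
    using bounded_linear.has_vector_derivative[OF bounded_linear_inner_left assms] .
  then show "((\<lambda>x. f x \<bullet> b) has_derivative (\<lambda>x. (x *\<^sub>R f') \<bullet> b)) (at t)"
    by (simp add: b inner_axis has_vector_derivative_def)
qed

lemma has_vector_derivative_matrixI:
  fixes M :: "real \<Rightarrow> real^'a^'b"
  assumes "\<And>i j. ((\<lambda>t. M t $ i $ j) has_real_derivative M' $ i $ j) (at t)"
  shows "(M has_vector_derivative M') (at t)"
  by (intro has_vector_derivative_vecI)
    (use assms in \<open>simp add: has_real_derivative_iff_has_vector_derivative\<close>)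

lemma has_real_derivative_matrix_nth:
  fixes M :: "real \<Rightarrow> real^'a^'b"
  assumes "(M has_vector_derivative M') F"
  shows "((\<lambda>t. M t $ i $ j) has_real_derivative M' $ i $ j) F"
  unfolding has_real_derivative_iff_has_vector_derivative
  by (intro has_vector_derivative_vec_nth assms)

text \<open>Product rule in the Leibniz expansion: the k-th summand is the determinant with row
  \<open>k\<close> differentiated.\<close>

lemma has_real_derivative_det:
  fixes M :: "real \<Rightarrow> real^'k^'k"
  assumes "(M has_vector_derivative M') (at t)"
  shows "((\<lambda>s. det (M s)) has_real_derivative
           (\<Sum>k\<in>UNIV. det (\<chi> i. if i = k then M' $ i else M t $ i))) (at t)"
proof -
  have prod: "((\<lambda>s. \<Prod>i\<in>UNIV. M s $ i $ p i) has_real_derivative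
      (\<Sum>k\<in>UNIV. M' $ k $ p k * (\<Prod>i\<in>UNIV-{k}. M t $ i $ p i))) (at t)" for p
    unfolding has_field_derivative_def
    by (rule has_derivative_eq_rhs[OF has_derivative_prod])
      (use has_real_derivative_matrix_nth[OF assms] in
        \<open>auto simp: has_field_derivative_def fun_eq_iff sum_distrib_right sum_distrib_left ac_simps\<close>)
  have row: "(\<Prod>i\<in>UNIV. (\<chi> i. if i = k then M' $ i else M t $ i) $ i $ p i) =
      M' $ k $ p k * (\<Prod>i\<in>UNIV-{k}. M t $ i $ p i)" for k p
    by (subst prod.remove[of _ k]) (auto intro!: prod.cong)
  have "((\<lambda>s. det (M s)) has_real_derivative
      (\<Sum>p | p permutes UNIV. of_int (sign p) *
        (\<Sum>k\<in>UNIV. M' $ k $ p k * (\<Prod>i\<in>UNIV-{k}. M t $ i $ p i)))) (at t)"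
    unfolding det_def by (intro DERIV_sum DERIV_cmult prod)
  then show ?thesis
    unfolding det_def row sum_distrib_left
    by (subst sum.swap)
qed

lemma matrix_inv_det_nz:
  fixes M :: "real^'k^'k"
  assumes "det M \<noteq> 0"
  shows "M ** matrix_inv M = mat 1" "matrix_inv M ** M = mat 1"
proof -
  have "\<exists>N. M ** N = mat 1 \<and> N ** M = mat 1"
    using assms unfolding invertible_det_nz[symmetric] invertible_def .
  from someI_ex[OF this] show "M ** matrix_inv M = mat 1" "matrix_inv M ** M = mat 1"
    unfolding matrix_inv_def by auto
qed

text \<open>With \<open>M' = X ** M t\<close>, row \<open>k\<close> of \<open>M'\<close> is a
  combination of the rows of \<open>M t\<close>. Replacing row \<open>k\<close> of
  \<open>M t\<close> by it multiplies the determinant by the diagonal entry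
  \<open>X $ k $ k\<close>, and these entries sum to the trace.\<close>

lemma has_real_derivative_det_Jacobi:
  fixes M :: "real \<Rightarrow> real^'k^'k"
  assumes M: "(M has_vector_derivative M') (at t)" and nz: "det (M t) \<noteq> 0"
  shows "((\<lambda>s. det (M s)) has_real_derivative trace (M' ** matrix_inv (M t)) * det (M t)) (at t)"
proof -
  define X where "X = M' ** matrix_inv (M t)"
  have "X ** M t = M'"
    by (simp add: X_def matrix_mul_assoc[symmetric] matrix_inv_det_nz[OF nz])
  then have row: "M' $ k = (\<Sum>j\<in>UNIV. (X $ k) $ j *s row j (M t))" for k
    by (auto simp: vec_eq_iff matrix_matrix_mult_def row_def)
  have "det (\<chi> i. if i = k then M' $ i else M t $ i) = X $ k $ k * det (M t)" for k
  proof -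
    have "(\<chi> i. if i = k then M' $ i else M t $ i) =
        (\<chi> i. if i = k then (\<Sum>j\<in>UNIV. (X $ k) $ j *s row j (M t)) else row i (M t))"
      by (auto simp: vec_eq_iff row[symmetric]) (simp add: row_def)
    then show ?thesis using cramer_lemma_transpose[of k "X $ k" "M t"] by simp
  qed
  then show ?thesis
    using has_real_derivative_det[OF M] by (simp add: X_def trace_def sum_distrib_right)
qed

text \<open>Cramer's rule for column \<open>l\<close> of the inverse. It exhibits the entries as
  quotients of determinants, which makes them differentiable.\<close>

lemma matrix_inv_nth_Cramer:
  fixes M :: "real^'k^'k"
  assumes "det M \<noteq> 0"
  shows "matrix_inv M $ k $ l = det (\<chi> i j. if j = k then axis l 1 $ i else M $ i $ j) / det M"
proof -
  have "M *v (matrix_inv M *v axis l 1) = axis l 1"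
    by (simp add: matrix_vector_mul_assoc matrix_inv_det_nz assms)
  then have "matrix_inv M *v axis l 1 = (\<chi> k. det (\<chi> i j. if j = k then axis l 1 $ i else M $ i $ j) / det M)"
    using cramer[OF assms] by blast
  then have "(matrix_inv M *v axis l 1) $ k = det (\<chi> i j. if j = k then axis l 1 $ i else M $ i $ j) / det M"
    by simp
  then show ?thesis
    by (simp add: matrix_vector_mult_basis column_def)
qed

text \<open>Cramer's rule gives the existence of a derivative; its value then follows by
  differentiating \<open>M s ** matrix_inv (M s) = mat 1\<close>, which holds near \<open>t\<close>
  because the determinant stays nonzero there.\<close>

lemma has_vector_derivative_matrix_inv:
  fixes M :: "real \<Rightarrow> real^'k^'k"
  assumes M: "(M has_vector_derivative M') (at t)" and nz: "det (M t) \<noteq> 0"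
  shows "((\<lambda>s. matrix_inv (M s)) has_vector_derivative
           - (matrix_inv (M t) ** M' ** matrix_inv (M t))) (at t)"
proof -
  have "isCont (\<lambda>s. det (M s)) t"
    using has_real_derivative_det[OF M] by (rule DERIV_isCont)
  then have ev: "\<forall>\<^sub>F s in nhds t. det (M s) \<noteq> 0"
    using nz by (simp add: isCont_def tendsto_imp_eventually_ne eventually_nhds_conv_at)
  have "\<exists>d. ((\<lambda>s. matrix_inv (M s) $ k $ l) has_real_derivative d) (at t)" for k l
  proof -
    let ?C = "\<lambda>M. (\<chi> i j. if j = k then axis l 1 $ i else M $ i $ j) :: real^'k^'k"
    have "((\<lambda>s. ?C (M s)) has_vector_derivative (\<chi> i j. if j = k then 0 else M' $ i $ j)) (at t)"
      by (rule has_vector_derivative_matrixI) (simp add: has_real_derivative_matrix_nth[OF M])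
    note DERIV_divide[OF has_real_derivative_det[OF this] has_real_derivative_det[OF M] nz]
    then obtain d where "((\<lambda>s. det (?C (M s)) / det (M s)) has_real_derivative d) (at t)"
      by blast
    moreover have "\<forall>\<^sub>F s in nhds t. matrix_inv (M s) $ k $ l = det (?C (M s)) / det (M s)"
      using ev by (rule eventually_mono) (rule matrix_inv_nth_Cramer)
    ultimately have "((\<lambda>s. matrix_inv (M s) $ k $ l) has_real_derivative d) (at t)"
      by (simp add: DERIV_cong_ev[OF refl _ refl])
    then show ?thesis ..
  qed
  then obtain N' where "\<And>k l. ((\<lambda>s. matrix_inv (M s) $ k $ l) has_real_derivative N' k l) (at t)"
    by metis
  then have N: "((\<lambda>s. matrix_inv (M s)) has_vector_derivative (\<chi> k l. N' k l)) (at t)"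
    by (intro has_vector_derivative_matrixI) simp
  let ?N' = "(\<chi> k l. N' k l) :: real^'k^'k" and ?N = "matrix_inv (M t)"
  have "((\<lambda>s. M s ** matrix_inv (M s)) has_vector_derivative M t ** ?N' + M' ** ?N) (at t)"
    by (intro has_vector_derivative_matrix_mult M N)
  moreover have "((\<lambda>s. M s ** matrix_inv (M s)) has_vector_derivative 0) (at t)"
    unfolding has_vector_derivative_def
    by (rule has_derivative_transform_eventually[where f = "\<lambda>_. mat 1"])
      (use ev in \<open>auto simp: matrix_inv_det_nz eventually_nhds_conv_at elim!: eventually_mono\<close>)
  ultimately have "M t ** ?N' + M' ** ?N = 0"
    by (rule vector_derivative_unique_at)
  then have "?N ** (M t ** ?N' + M' ** ?N) = 0"
    by (simp add: bounded_bilinear.zero_right[OF bounded_bilinear_matrix_mult])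
  then have "?N' = - (?N ** M' ** ?N)"
    by (simp add: matrix_bilinear_simps matrix_inv_det_nz[OF nz] eq_neg_iff_add_eq_0)
  with N show ?thesis by simp
qed

subsection \<open>First variation of the geometric data\<close>

lemma inner_matrix_vector_right:
  fixes M :: "real^'a^'b"
  shows "x \<bullet> (M *v y) = (transpose M *v x) \<bullet> y"
  by (simp add: transpose_matrix_vector dot_lmul_matrix)

lemma transpose_matrix_inv:
  fixes M :: "real^'k^'k"
  assumes "transpose M = M" and nz: "det M \<noteq> 0"
  shows "transpose (matrix_inv M) = matrix_inv M"
proof -
  have "transpose (matrix_inv M ** M) = mat 1"
    by (simp add: matrix_inv_det_nz[OF nz])
  then have "M ** transpose (matrix_inv M) = mat 1"
    by (simp add: matrix_transpose_mul assms(1))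
  then have "matrix_inv M ** M ** transpose (matrix_inv M) = matrix_inv M"
    by (simp add: matrix_mul_assoc[symmetric])
  then show ?thesis
    by (simp add: matrix_inv_det_nz[OF nz])
qed

lemma trace_transpose: "trace (transpose M) = trace M"
  by (simp add: trace_def transpose_def)

definition gram :: "real^'m^'m \<Rightarrow> real^'m^'n \<Rightarrow> real^'n^'n" where
  "gram H z = z ** H ** transpose z"

text \<open>Applied to an ambient vector, this gives the coordinates of its orthogonal projection to
  the tangent space in the basis of rows of \<open>z\<close>. It is \<open>Amat\<close> with the
  ambient index lowered.\<close>

definition tang_proj :: "real^'m^'m \<Rightarrow> real^'m^'n \<Rightarrow> real^'m^'n" where
  "tang_proj H z = matrix_inv (gram H z) ** z ** H"

definition tang_vec :: "real^'m^'m \<Rightarrow> real^'m \<Rightarrow> real^'m^'n \<Rightarrow> real^'n" where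
  "tang_vec H W z = matrix_inv (gram H z) *v (z *v (H *v W))"

definition normal_covec :: "real^'m^'m \<Rightarrow> real^'m \<Rightarrow> real^'m^'n \<Rightarrow> real^'m" where
  "normal_covec H W z = H *v W - transpose (z ** H) *v tang_vec H W z"

text \<open>For symmetric \<open>H\<close> this is the normal projector with its index lowered, the
  difference of the metric and \<open>Blow\<close> in the theorem.\<close>

definition normal_metric :: "real^'m^'m \<Rightarrow> real^'m^'n \<Rightarrow> real^'m^'m" where
  "normal_metric H z = H - transpose (z ** H) ** matrix_inv (gram H z) ** z ** H"

text \<open>The last summand pairs the covector \<open>W_i\<close> with its raised version
  \<open>tang_vec\<close>, so it is the squared \<open>h\<close>-norm of \<open>W_i\<close>.\<close>

definition nav_s :: "real^'m^'m \<Rightarrow> real^'m \<Rightarrow> real^'m^'n \<Rightarrow> real" where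
  "nav_s H W z = 1 - W \<bullet> (H *v W) + (z *v (H *v W)) \<bullet> tang_vec H W z"

text \<open>The variation of \<open>(H, W, z)\<close> is split into an infinitesimal change of frame \<open>L\<close> of the
  ambient space and a remainder \<open>(0, C, u)\<close>. All objects below are equivariant, so that only the
  remainder contributes to scalars. Partial derivatives in \<open>z\<close> are the case \<open>L = 0\<close>, \<open>C = 0\<close>; for the
  partial derivative in an ambient coordinate, \<open>L\<close> consists of Christoffel symbols and \<open>C\<close> is a
  covariant derivative of \<open>W\<close>.\<close>

locale variation =
  fixes H :: "real \<Rightarrow> real^'m^'m" and W :: "real \<Rightarrow> real^'m" and z :: "real \<Rightarrow> real^'m^'n"
    and L :: "real^'m^'m" and C :: "real^'m" and u :: "real^'m^'n"
  assumes dH: "(H has_vector_derivative transpose L ** H 0 + H 0 ** L) (at 0)"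
    and dW: "(W has_vector_derivative C - L *v W 0) (at 0)"
    and dz: "(z has_vector_derivative u - z 0 ** transpose L) (at 0)"
    and sym: "transpose (H 0) = H 0"
    and nz: "det (gram (H 0) (z 0)) \<noteq> 0"
begin

abbreviation "N \<equiv> matrix_inv (gram (H 0) (z 0))"
abbreviation "\<zeta> \<equiv> z 0 ** H 0"
abbreviation "A \<equiv> tang_proj (H 0) (z 0)"
abbreviation "q \<equiv> tang_vec (H 0) (W 0) (z 0)"
abbreviation "\<nu> \<equiv> normal_covec (H 0) (W 0) (z 0)"
abbreviation "E \<equiv> normal_metric (H 0) (z 0)"
abbreviation "c \<equiv> H 0 *v C"

lemma sym_N: "transpose N = N"
  by (rule transpose_matrix_inv[OF _ nz]) (simp add: gram_def sym matrix_bilinear_simps)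

lemmas var_simps = matrix_bilinear_simps sym sym_N algebra_simps

lemma d_lower: "((\<lambda>t. H t *v W t) has_vector_derivative transpose L *v (H 0 *v W 0) + c) (at 0)"
  by (rule has_vector_derivative_eq_rhs[OF has_vector_derivative_matrix_vector_mult[OF dH dW]])
    (simp add: var_simps)

lemma d_zeta: "((\<lambda>t. z t ** H t) has_vector_derivative u ** H 0 + \<zeta> ** L) (at 0)"
  by (rule has_vector_derivative_eq_rhs[OF has_vector_derivative_matrix_mult[OF dz dH]])
    (simp add: var_simps)

text \<open>The induced metric has no ambient index, so the terms with \<open>L\<close>
  cancel.\<close>

lemma d_gram: "((\<lambda>t. gram (H t) (z t)) has_vector_derivative u ** transpose \<zeta> + \<zeta> ** transpose u) (at 0)"
  unfolding gram_def
  by (rule has_vector_derivative_eq_rhs[OF has_vector_derivative_matrix_mult[OF d_zeta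
        has_vector_derivative_transpose[OF dz]]])
    (simp add: var_simps)

lemma d_inv:
  "((\<lambda>t. matrix_inv (gram (H t) (z t))) has_vector_derivative
      - (N ** (u ** transpose \<zeta> + \<zeta> ** transpose u) ** N)) (at 0)"
  by (rule has_vector_derivative_matrix_inv[OF d_gram nz])

text \<open>The ambient covector index leaves the frame term \<open>A ** L\<close>. One half of the
  derivative of \<open>N\<close> completes \<open>N ** u ** H 0\<close> to
  \<open>N ** u ** E\<close>, the other half is the last term.\<close>

lemma d_tang_proj:
  "((\<lambda>t. tang_proj (H t) (z t)) has_vector_derivative A ** L + N ** u ** E - A ** transpose u ** A) (at 0)"
  unfolding tang_proj_def matrix_mul_assoc[symmetric]
  by (rule has_vector_derivative_eq_rhs[OF has_vector_derivative_matrix_mult[OF d_inv d_zeta]])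
    (simp add: var_simps normal_metric_def)

lemma d_tang_vec:
  "((\<lambda>t. tang_vec (H t) (W t) (z t)) has_vector_derivative
      N *v (u *v \<nu>) - A *v (transpose u *v q) + N *v (z 0 *v c)) (at 0)"
  unfolding tang_vec_def
  by (rule has_vector_derivative_eq_rhs[OF has_vector_derivative_matrix_vector_mult[OF d_inv
        has_vector_derivative_matrix_vector_mult[OF dz d_lower]]])
    (simp add: var_simps normal_covec_def tang_vec_def tang_proj_def)

lemma d_normal_covec:
  "((\<lambda>t. normal_covec (H t) (W t) (z t)) has_vector_derivative
      transpose L *v \<nu> - E *v (transpose u *v q) - transpose A *v (u *v \<nu>)
      + c - transpose \<zeta> *v (N *v (z 0 *v c))) (at 0)"
  unfolding normal_covec_def
  by (rule has_vector_derivative_eq_rhs[OF has_vector_derivative_diff[OF d_lower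
        has_vector_derivative_matrix_vector_mult[OF has_vector_derivative_transpose[OF d_zeta] d_tang_vec]]])
    (simp add: var_simps normal_covec_def tang_vec_def tang_proj_def normal_metric_def)

lemma d_norm_W2:
  "((\<lambda>t. W t \<bullet> (H t *v W t)) has_real_derivative 2 * (W 0 \<bullet> c)) (at 0)"
  unfolding has_real_derivative_iff_has_vector_derivative
proof (rule has_vector_derivative_eq_rhs[OF bounded_bilinear.has_vector_derivative[OF
        bounded_bilinear_inner dW d_lower]])
  have "C \<bullet> (H 0 *v W 0) = W 0 \<bullet> c"
    using inner_matrix_vector_right[of C "H 0" "W 0"] by (simp add: sym inner_commute)
  moreover have "W 0 \<bullet> (transpose L *v (H 0 *v W 0)) = (L *v W 0) \<bullet> (H 0 *v W 0)"
    using inner_matrix_vector_right[of "W 0" "transpose L"] by simp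
  ultimately show "W 0 \<bullet> (transpose L *v (H 0 *v W 0) + c) + (C - L *v W 0) \<bullet> (H 0 *v W 0) = 2 * (W 0 \<bullet> c)"
    by (simp add: inner_add_right inner_diff_left)
qed

lemma d_norm_tang2:
  "((\<lambda>t. (z t *v (H t *v W t)) \<bullet> tang_vec (H t) (W t) (z t)) has_real_derivative
      2 * (q \<bullet> (u *v \<nu>)) + 2 * (q \<bullet> (z 0 *v c))) (at 0)"
  unfolding has_real_derivative_iff_has_vector_derivative
proof (rule has_vector_derivative_eq_rhs[OF bounded_bilinear.has_vector_derivative[OF
        bounded_bilinear_inner has_vector_derivative_matrix_vector_mult[OF dz d_lower] d_tang_vec]])
  let ?X = "z 0 *v (H 0 *v W 0)"
  have X: "?X \<bullet> (N *v y) = q \<bullet> y" for y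
    using inner_matrix_vector_right[of ?X N y] by (simp add: sym_N tang_vec_def)
  have "?X \<bullet> (A *v (transpose u *v q)) = q \<bullet> (\<zeta> *v (transpose u *v q))"
    using X[of "\<zeta> *v (transpose u *v q)"] by (simp add: tang_proj_def matrix_bilinear_simps)
  also have "\<dots> = q \<bullet> (u *v (transpose \<zeta> *v q))"
    using inner_matrix_vector_right[of q \<zeta> "transpose u *v q"]
      inner_matrix_vector_right[of q u "transpose \<zeta> *v q"] by (simp add: inner_commute)
  \<comment> \<open>The covector \<open>transpose \<zeta> *v q\<close> is the lowered tangential
    part of \<open>W 0\<close>, that is \<open>H 0 *v W 0 - \<nu>\<close>. Its first term cancels
    against the derivative of \<open>z\<close>, its second doubles the term with
    \<open>\<nu>\<close>.\<close>
  finally have A: "?X \<bullet> (A *v (transpose u *v q)) = q \<bullet> (u *v (H 0 *v W 0)) - q \<bullet> (u *v \<nu>)"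
    by (simp add: normal_covec_def matrix_vector_mult_diff_distrib inner_diff_right)
  have dX: "z 0 *v (transpose L *v (H 0 *v W 0) + c) + (u - z 0 ** transpose L) *v (H 0 *v W 0)
      = u *v (H 0 *v W 0) + z 0 *v c"
    by (simp add: var_simps)
  show "?X \<bullet> (N *v (u *v \<nu>) - A *v (transpose u *v q) + N *v (z 0 *v c)) +
      (z 0 *v (transpose L *v (H 0 *v W 0) + c) + (u - z 0 ** transpose L) *v (H 0 *v W 0)) \<bullet> q =
      2 * (q \<bullet> (u *v \<nu>)) + 2 * (q \<bullet> (z 0 *v c))"
    unfolding dX by (simp add: inner_add_right inner_diff_right inner_add_left A X inner_commute[of _ q])
qed

definition "ds = 2 * (q \<bullet> (u *v \<nu>)) + 2 * (q \<bullet> (z 0 *v c)) - 2 * (W 0 \<bullet> c)"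

lemma d_nav_s: "((\<lambda>t. nav_s (H t) (W t) (z t)) has_real_derivative ds) (at 0)"
  unfolding nav_s_def
  by (rule derivative_eq_intros d_norm_tang2 d_norm_W2 refl)+ (simp add: ds_def)

lemma d_sqrt_det:
  "((\<lambda>t. sqrt (det (gram (H t) (z t)))) has_real_derivative
      sqrt (det (gram (H 0) (z 0))) * trace (A ** transpose u)) (at 0)"
proof -
  have "trace (u ** transpose \<zeta> ** N) = trace (A ** transpose u)"
    by (subst trace_transpose[symmetric]) (simp add: var_simps tang_proj_def)
  moreover have "trace (\<zeta> ** transpose u ** N) = trace (A ** transpose u)"
    using trace_mul_sym[of "\<zeta> ** transpose u" N] by (simp add: matrix_bilinear_simps tang_proj_def)
  ultimately have tr: "trace ((u ** transpose \<zeta> + \<zeta> ** transpose u) ** N) = 2 * trace (A ** transpose u)"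
    by (simp add: bounded_bilinear.add_left[OF bounded_bilinear_matrix_mult] trace_add)
  let ?d = "det (gram (H 0) (z 0))"
  have "((\<lambda>t. det (gram (H t) (z t))) has_real_derivative 2 * trace (A ** transpose u) * ?d) (at 0)"
    using has_real_derivative_det_Jacobi[OF d_gram nz] unfolding tr .
  \<comment> \<open>\<open>sqrt\<close> is an odd function, so this form of the derivative is valid
    for either sign of the determinant.\<close>
  moreover have "(sqrt has_real_derivative sqrt ?d / (2 * ?d)) (at ?d)"
    by (rule DERIV_real_sqrt_generic[OF nz])
      (use real_sqrt_pow2[of ?d] real_sqrt_pow2[of "- ?d"] in
        \<open>auto simp: field_simps power2_eq_square real_sqrt_minus\<close>)
  ultimately show ?thesis
    using DERIV_chain2 nz by fastforce
qed

end

subsection \<open>First variation of the volume density\<close>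

text \<open>Both volume forms are powers of \<open>s\<close>, so one computation of derivatives
  serves both.\<close>

lemma rho_eq_powr: "\<exists>a. rho v n = (\<lambda>s. s powr a)"
  by (cases v) (auto simp: rho_def fun_eq_iff)

lemma DERIV_rho:
  assumes "s > 0"
  shows "(rho v n has_real_derivative deriv (rho v n) s) (at s)"
    and "(deriv (rho v n) has_real_derivative deriv (deriv (rho v n)) s) (at s)"
proof -
  obtain a where a: "rho v n = (\<lambda>s. s powr a)"
    using rho_eq_powr by blast
  have d: "((\<lambda>s. s powr b) has_real_derivative b * t powr (b - 1)) (at t)" if "t > 0" for b t :: real
    using that by (auto intro!: derivative_eq_intros simp: field_simps powr_diff)
  have d1: "(rho v n has_real_derivative a * t powr (a - 1)) (at t)" if "t > 0" for t
    unfolding a by (rule d[OF that])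
  then show "(rho v n has_real_derivative deriv (rho v n) s) (at s)"
    using assms DERIV_imp_deriv by metis
  \<comment> \<open>The closed form of the first derivative is established on the positive
    half-line, which is a neighbourhood of \<open>s\<close>; this suffices to differentiate
    again.\<close>
  have "\<forall>\<^sub>F t in nhds s. deriv (rho v n) t = a * t powr (a - 1)"
    using eventually_nhds_in_open[of "{0<..}" s] assms
    by (auto elim!: eventually_mono intro: DERIV_imp_deriv d1)
  moreover have "((\<lambda>t. a * t powr (a - 1)) has_real_derivative a * ((a - 1) * s powr (a - 1 - 1))) (at s)"
    by (intro DERIV_cmult d assms)
  ultimately have "(deriv (rho v n) has_real_derivative a * ((a - 1) * s powr (a - 1 - 1))) (at s)"
    by (simp add: DERIV_cong_ev[OF refl _ refl])
  then show "(deriv (rho v n) has_real_derivative deriv (deriv (rho v n)) s) (at s)"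
    by (simp add: DERIV_imp_deriv)
qed

lemma rho_pos: "s > 0 \<Longrightarrow> rho v n s > 0"
  by (cases v) (auto simp: rho_def)

lemma chi_pos: "w < 1 \<Longrightarrow> chi v n w > 0"
  by (cases v) (auto simp: chi_def)

text \<open>The density contains the factor \<open>1 / chi\<close>, whereas the theorem is stated
  with the logarithmic derivative of \<open>chi\<close>.\<close>

lemma DERIV_inverse_chi:
  assumes "w < 1"
  shows "((\<lambda>w. inverse (chi v n w)) has_real_derivative
           - deriv (\<lambda>u. ln (chi v n u)) w * inverse (chi v n w)) (at w)"
proof -
  have "\<exists>d. (chi v n has_real_derivative d) (at w)"
  proof (cases v)
    case BH
    then have "chi v n = (\<lambda>_. 1)" by (simp add: chi_def fun_eq_iff)
    then show ?thesis by (auto intro!: derivative_eq_intros exI)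
  next
    case HT
    then have "chi v n = (\<lambda>w. (1 - w) powr ((real n + 1) / 2))" by (simp add: chi_def fun_eq_iff)
    then show ?thesis using assms by (auto intro!: derivative_eq_intros exI)
  qed
  then obtain d where d: "(chi v n has_real_derivative d) (at w)" ..
  have pos: "chi v n w > 0" by (rule chi_pos[OF assms])
  have "((\<lambda>u. ln (chi v n u)) has_real_derivative d / chi v n w) (at w)"
    using DERIV_chain2[OF DERIV_ln_divide[OF pos] d] by simp
  then have "deriv (\<lambda>u. ln (chi v n u)) w = d / chi v n w"
    by (rule DERIV_imp_deriv)
  moreover have "((\<lambda>w. inverse (chi v n w)) has_real_derivative - (d / (chi v n w)\<^sup>2)) (at w)"
    using DERIV_inverse_fun[OF d] pos by (simp add: power2_eq_square divide_inverse ac_simps)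
  ultimately show ?thesis
    by (simp add: power2_eq_square field_simps)
qed

abbreviation log_chi_deriv :: "volume_kind \<Rightarrow> nat \<Rightarrow> real \<Rightarrow> real" where
  "log_chi_deriv v n w \<equiv> deriv (\<lambda>u. ln (chi v n u)) w"

definition vol :: "volume_kind \<Rightarrow> real^'m^'m \<Rightarrow> real^'m \<Rightarrow> real^'m^'n \<Rightarrow> real" where
  "vol v H W z = rho v CARD('n) (nav_s H W z) * inverse (chi v CARD('n) (W \<bullet> (H *v W)))
     * sqrt (det (gram H z))"

definition vol_scale :: "volume_kind \<Rightarrow> real^'m^'m \<Rightarrow> real^'m \<Rightarrow> real^'m^'n \<Rightarrow> real" where
  "vol_scale v H W z = inverse (chi v CARD('n) (W \<bullet> (H *v W))) * sqrt (det (gram H z))"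

text \<open>A closed form for the first partial derivative of the density in \<open>z\<close>,
  confirmed in \<open>pdz_volF\<close>. It is what gets differentiated a second time, in
  \<open>z\<close> and in the ambient coordinates.\<close>

definition vol_grad :: "volume_kind \<Rightarrow> real^'m^'m \<Rightarrow> real^'m \<Rightarrow> real^'m^'n \<Rightarrow> 'm \<Rightarrow> 'n \<Rightarrow> real" where
  "vol_grad v H W z g i = vol_scale v H W z *
     (rho v CARD('n) (nav_s H W z) * tang_proj H z $ i $ g
      + 2 * deriv (rho v CARD('n)) (nav_s H W z) * tang_vec H W z $ i * normal_covec H W z $ g)"

locale vol_variation = variation H W z L C u
  for H :: "real \<Rightarrow> real^'m^'m" and W :: "real \<Rightarrow> real^'m" and z :: "real \<Rightarrow> real^'m^'n"
    and L :: "real^'m^'m" and C :: "real^'m" and u :: "real^'m^'n" +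
  fixes v :: volume_kind
  assumes s_pos: "nav_s (H 0) (W 0) (z 0) > 0" and W_less: "W 0 \<bullet> (H 0 *v W 0) < 1"
begin

abbreviation "r \<equiv> rho v CARD('n) (nav_s (H 0) (W 0) (z 0))"
abbreviation "r1 \<equiv> deriv (rho v CARD('n)) (nav_s (H 0) (W 0) (z 0))"
abbreviation "r2 \<equiv> deriv (deriv (rho v CARD('n))) (nav_s (H 0) (W 0) (z 0))"
abbreviation "V \<equiv> vol_scale v (H 0) (W 0) (z 0)"

lemma d_vol_scale:
  "((\<lambda>t. vol_scale v (H t) (W t) (z t)) has_real_derivative
      V * (trace (A ** transpose u) - 2 * log_chi_deriv v CARD('n) (W 0 \<bullet> (H 0 *v W 0)) * (W 0 \<bullet> c))) (at 0)"
proof -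
  have "((\<lambda>t. inverse (chi v CARD('n) (W t \<bullet> (H t *v W t)))) has_real_derivative
      - log_chi_deriv v CARD('n) (W 0 \<bullet> (H 0 *v W 0)) * inverse (chi v CARD('n) (W 0 \<bullet> (H 0 *v W 0))) * (2 * (W 0 \<bullet> c))) (at 0)"
    by (rule DERIV_chain2[OF DERIV_inverse_chi[OF W_less] d_norm_W2])
  from DERIV_mult[OF this d_sqrt_det] show ?thesis
    unfolding vol_scale_def by (simp add: algebra_simps)
qed

lemma d_vol:
  "((\<lambda>t. vol v (H t) (W t) (z t)) has_real_derivative
      V * (r * (trace (A ** transpose u) - 2 * log_chi_deriv v CARD('n) (W 0 \<bullet> (H 0 *v W 0)) * (W 0 \<bullet> c)) + r1 * ds)) (at 0)"
proof -
  have "vol v (H t) (W t) (z t) = rho v CARD('n) (nav_s (H t) (W t) (z t)) * vol_scale v (H t) (W t) (z t)" for t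
    by (simp add: vol_def vol_scale_def)
  moreover note DERIV_mult[OF DERIV_chain2[OF DERIV_rho(1)[OF s_pos] d_nav_s] d_vol_scale]
  ultimately show ?thesis by (simp add: algebra_simps)
qed

definition "dA = A ** L + N ** u ** E - A ** transpose u ** A"
definition "dq = N *v (u *v \<nu>) - A *v (transpose u *v q) + N *v (z 0 *v c)"
definition "d\<nu> = transpose L *v \<nu> - E *v (transpose u *v q) - transpose A *v (u *v \<nu>)
      + c - transpose \<zeta> *v (N *v (z 0 *v c))"

lemma d_vol_grad:
  "((\<lambda>t. vol_grad v (H t) (W t) (z t) g i) has_real_derivative
      V * ((trace (A ** transpose u) - 2 * log_chi_deriv v CARD('n) (W 0 \<bullet> (H 0 *v W 0)) * (W 0 \<bullet> c)) * (r * A $ i $ g + 2 * r1 * q $ i * \<nu> $ g)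
        + ds * (r1 * A $ i $ g + 2 * r2 * q $ i * \<nu> $ g)
        + r * dA $ i $ g + 2 * r1 * (dq $ i * \<nu> $ g + q $ i * d\<nu> $ g))) (at 0)"
proof -
  have "((\<lambda>t. tang_proj (H t) (z t) $ i $ g) has_real_derivative dA $ i $ g) (at 0)"
    unfolding dA_def by (rule has_real_derivative_matrix_nth[OF d_tang_proj])
  moreover have "((\<lambda>t. tang_vec (H t) (W t) (z t) $ i) has_real_derivative dq $ i) (at 0)"
    unfolding dq_def has_real_derivative_iff_has_vector_derivative
    by (rule has_vector_derivative_vec_nth[OF d_tang_vec])
  moreover have "((\<lambda>t. normal_covec (H t) (W t) (z t) $ g) has_real_derivative d\<nu> $ g) (at 0)"
    unfolding d\<nu>_def has_real_derivative_iff_has_vector_derivative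
    by (rule has_vector_derivative_vec_nth[OF d_normal_covec])
  moreover have "((\<lambda>t. rho v CARD('n) (nav_s (H t) (W t) (z t))) has_real_derivative r1 * ds) (at 0)"
    by (rule DERIV_chain2[OF DERIV_rho(1)[OF s_pos] d_nav_s])
  moreover have "((\<lambda>t. deriv (rho v CARD('n)) (nav_s (H t) (W t) (z t))) has_real_derivative r2 * ds) (at 0)"
    by (rule DERIV_chain2[OF DERIV_rho(2)[OF s_pos] d_nav_s])
  ultimately show ?thesis
    unfolding vol_grad_def
    by (auto intro!: derivative_eq_intros d_vol_scale simp: algebra_simps)
qed

end

subsection \<open>Partial derivatives and the coordinate expressions\<close>

text \<open>\<open>pd\<close> is a \<open>deriv\<close> at parameter 0 of a line starting at the
  point itself. Frechet differentiability identifies it with the derivative, at any parameter, of a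
  line passing through that point.\<close>

lemma DERIV_pd_line:
  assumes "g differentiable_on U" "open U" "y + s *\<^sub>R axis k 1 \<in> U"
  shows "((\<lambda>s. g (y + s *\<^sub>R axis k 1)) has_real_derivative pd g k (y + s *\<^sub>R axis k 1)) (at s)"
proof -
  let ?p = "y + s *\<^sub>R axis k 1"
  obtain g' where g': "(g has_derivative g') (at ?p)"
    using assms differentiable_on_eq_differentiable_at[of U g] by (auto simp: differentiable_def)
  interpret bounded_linear g' using g' by (rule has_derivative_bounded_linear)
  \<comment> \<open>Used for the line based at \<open>?p\<close> with parameter 0 and for the line
    based at \<open>y\<close> with parameter \<open>s\<close>.\<close>
  have line: "((\<lambda>t. g (p + t *\<^sub>R axis k 1)) has_real_derivative g' (axis k 1)) (at t)"
    if "p + t *\<^sub>R axis k 1 = ?p" for p t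
  proof -
    have "((\<lambda>t. p + t *\<^sub>R axis k 1) has_derivative (\<lambda>t. t *\<^sub>R axis k 1)) (at t)"
      by (auto intro!: derivative_eq_intros)
    from has_derivative_compose[OF this, of g g'] g' that
    have "((\<lambda>t. g (p + t *\<^sub>R axis k 1)) has_derivative (\<lambda>t. g' (t *\<^sub>R axis k 1))) (at t)"
      by simp
    then show ?thesis
      unfolding has_field_derivative_def by (rule has_derivative_eq_rhs) (simp add: fun_eq_iff scaleR)
  qed
  from line[of ?p 0] have "pd g k ?p = g' (axis k 1)"
    unfolding pd_def by (intro DERIV_imp_deriv) simp
  with line[of y s] show ?thesis by simp
qed

lemma DERIV_pd:
  assumes "g differentiable_on U" "open U" "y \<in> U"
  shows "((\<lambda>s. g (y + s *\<^sub>R axis k 1)) has_real_derivative pd g k y) (at 0)"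
  using DERIV_pd_line[of g U y 0 k] assms by simp

text \<open>Mean value theorem twice: first in direction \<open>i\<close> for the difference
  \<open>\<phi>\<close> taken in direction \<open>j\<close>, then in direction
  \<open>j\<close>.\<close>

lemma second_difference_mvt:
  assumes g: "g differentiable_on U" "pd g i differentiable_on U" "open U"
    and h: "h > 0" and box: "\<And>s t. \<lbrakk>0 \<le> s; s \<le> h; 0 \<le> t; t \<le> h\<rbrakk> \<Longrightarrow> x + s *\<^sub>R axis i 1 + t *\<^sub>R axis j 1 \<in> U"
  shows "\<exists>s t. 0 < s \<and> s < h \<and> 0 < t \<and> t < h \<and>
    g (x + h *\<^sub>R axis i 1 + h *\<^sub>R axis j 1) - g (x + h *\<^sub>R axis i 1) - g (x + h *\<^sub>R axis j 1) + g x
      = h * h * pd (pd g i) j (x + s *\<^sub>R axis i 1 + t *\<^sub>R axis j 1)"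
proof -
  define \<phi> where "\<phi> s = g ((x + h *\<^sub>R axis j 1) + s *\<^sub>R axis i 1) - g (x + s *\<^sub>R axis i 1)" for s
  have d\<phi>: "(\<phi> has_real_derivative
      pd g i ((x + h *\<^sub>R axis j 1) + s *\<^sub>R axis i 1) - pd g i (x + s *\<^sub>R axis i 1)) (at s)"
    if "0 \<le> s" "s \<le> h" for s
    unfolding \<phi>_def
    by (intro DERIV_diff DERIV_pd_line[OF g(1,3)])
      (use box[of s h] box[of s 0] that h in \<open>auto simp: algebra_simps\<close>)
  obtain s where s: "0 < s" "s < h" and eq1: "\<phi> h - \<phi> 0 =
      h * (pd g i ((x + h *\<^sub>R axis j 1) + s *\<^sub>R axis i 1) - pd g i (x + s *\<^sub>R axis i 1))"
    using MVT2[OF h d\<phi>] by auto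
  have d2: "((\<lambda>t. pd g i ((x + s *\<^sub>R axis i 1) + t *\<^sub>R axis j 1)) has_real_derivative
      pd (pd g i) j ((x + s *\<^sub>R axis i 1) + t *\<^sub>R axis j 1)) (at t)" if "0 \<le> t" "t \<le> h" for t
    by (intro DERIV_pd_line[OF g(2,3)]) (use box[of s t] that s in auto)
  obtain t where t: "0 < t" "t < h" and eq2: "pd g i (x + s *\<^sub>R axis i 1 + h *\<^sub>R axis j 1)
      - pd g i (x + s *\<^sub>R axis i 1) = h * pd (pd g i) j (x + s *\<^sub>R axis i 1 + t *\<^sub>R axis j 1)"
    using MVT2[OF h d2] by auto
  have "\<phi> h - \<phi> 0 = h * h * pd (pd g i) j (x + s *\<^sub>R axis i 1 + t *\<^sub>R axis j 1)"
    using eq1 eq2 by (simp add: algebra_simps)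
  then show ?thesis
    using s t by (intro exI[of _ s] exI[of _ t]) (simp add: \<phi>_def algebra_simps)
qed

text \<open>The second difference over a small square is symmetric in the two directions and equals
  \<open>h * h\<close> times either mixed derivative at some nearby point. Continuity then excludes
  different values at \<open>x\<close>.\<close>

lemma pd_commute:
  assumes "open U" "x \<in> U" and g: "Ck_on 2 U g"
  shows "pd (pd g i) j x = pd (pd g j) i x"
proof (rule ccontr)
  have ck: "g differentiable_on U" "\<And>i. pd g i differentiable_on U" "\<And>i j. continuous_on U (pd (pd g i) j)"
    using g by (auto simp: numeral_2_eq_2)
  assume neq: "pd (pd g i) j x \<noteq> pd (pd g j) i x"
  \<comment> \<open>Half the gap: no number is closer than \<open>e\<close> to both mixed
    derivatives.\<close>
  define e where "e = \<bar>pd (pd g i) j x - pd (pd g j) i x\<bar> / 2"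
  have "e > 0" using neq by (simp add: e_def)
  have "\<exists>d>0. \<forall>y. dist y x < d \<longrightarrow> y \<in> U \<and> dist (pd (pd g i) j y) (pd (pd g i) j x) < e" for i j
  proof -
    have "isCont (pd (pd g i) j) x"
      using ck(3) assms(1,2) by (simp add: continuous_on_eq_continuous_at)
    then have "\<forall>\<^sub>F y in nhds x. dist (pd (pd g i) j y) (pd (pd g i) j x) < e"
      using \<open>e > 0\<close> by (auto simp: isCont_def tendsto_iff eventually_nhds_conv_at)
    moreover have "\<forall>\<^sub>F y in nhds x. y \<in> U"
      using assms(1,2) by (rule eventually_nhds_in_open)
    ultimately have "\<forall>\<^sub>F y in nhds x. y \<in> U \<and> dist (pd (pd g i) j y) (pd (pd g i) j x) < e"
      by (rule eventually_conj[rotated])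
    then show ?thesis
      unfolding eventually_nhds_metric .
  qed
  note * = this
  obtain d1 where d1: "d1 > 0" "\<And>y. dist y x < d1 \<Longrightarrow> y \<in> U \<and> dist (pd (pd g i) j y) (pd (pd g i) j x) < e"
    using *[of i j] by blast
  obtain d2 where d2: "d2 > 0" "\<And>y. dist y x < d2 \<Longrightarrow> dist (pd (pd g j) i y) (pd (pd g j) i x) < e"
    using *[of j i] by blast
  \<comment> \<open>Points of the square have distance at most \<open>2 * h\<close> from
    \<open>x\<close>, which a third keeps strictly below both radii.\<close>
  define h where "h = min d1 d2 / 3"
  have h: "h > 0" using d1 d2 by (simp add: h_def)
  have near: "dist (x + s *\<^sub>R axis k 1 + t *\<^sub>R axis l 1) x < min d1 d2"
    if "0 \<le> s" "s \<le> h" "0 \<le> t" "t \<le> h" for s t k l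
  proof -
    have "dist (x + s *\<^sub>R axis k 1 + t *\<^sub>R axis l 1) x = norm (s *\<^sub>R axis k 1 + t *\<^sub>R axis l (1::real))"
      by (simp add: dist_norm)
    also have "\<dots> \<le> s + t"
      by (rule order_trans[OF norm_triangle_ineq]) (use that in simp)
    also have "\<dots> < min d1 d2"
      using that d1 d2 by (simp add: h_def)
    finally show ?thesis .
  qed
  have inU: "x + s *\<^sub>R axis k 1 + t *\<^sub>R axis l 1 \<in> U" if "0 \<le> s" "s \<le> h" "0 \<le> t" "t \<le> h" for s t k l
    using near[OF that, of k l] d1(2) by simp
  obtain s t where st: "0 < s" "s < h" "0 < t" "t < h"
    "g (x + h *\<^sub>R axis i 1 + h *\<^sub>R axis j 1) - g (x + h *\<^sub>R axis i 1) - g (x + h *\<^sub>R axis j 1) + g x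
      = h * h * pd (pd g i) j (x + s *\<^sub>R axis i 1 + t *\<^sub>R axis j 1)"
    using second_difference_mvt[OF ck(1) ck(2) assms(1) h inU] by blast
  obtain s' t' where st': "0 < s'" "s' < h" "0 < t'" "t' < h"
    "g (x + h *\<^sub>R axis j 1 + h *\<^sub>R axis i 1) - g (x + h *\<^sub>R axis j 1) - g (x + h *\<^sub>R axis i 1) + g x
      = h * h * pd (pd g j) i (x + s' *\<^sub>R axis j 1 + t' *\<^sub>R axis i 1)"
    using second_difference_mvt[OF ck(1) ck(2) assms(1) h inU] by blast
  have "h * h * pd (pd g i) j (x + s *\<^sub>R axis i 1 + t *\<^sub>R axis j 1)
      = h * h * pd (pd g j) i (x + s' *\<^sub>R axis j 1 + t' *\<^sub>R axis i 1)"
    using st(5) st'(5) by (simp add: algebra_simps)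
  then have "pd (pd g i) j (x + s *\<^sub>R axis i 1 + t *\<^sub>R axis j 1)
      = pd (pd g j) i (x + s' *\<^sub>R axis j 1 + t' *\<^sub>R axis i 1)"
    using h by simp
  moreover have "dist (pd (pd g i) j (x + s *\<^sub>R axis i 1 + t *\<^sub>R axis j 1)) (pd (pd g i) j x) < e"
    using near[of s t i j] st d1 by auto
  moreover have "dist (pd (pd g j) i (x + s' *\<^sub>R axis j 1 + t' *\<^sub>R axis i 1)) (pd (pd g j) i x) < e"
    using near[of s' t' j i] st' d2 by auto
  ultimately show False
    by (simp add: e_def dist_real_def abs_if split: if_splits)
qed

section \<open>Index sums as matrix expressions\<close>

lemma matrix_matrix_mult_nth: "(M ** N) $ i $ j = (\<Sum>k\<in>UNIV. M $ i $ k * N $ k $ j)"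
  by (simp add: matrix_matrix_mult_def)

lemma matrix_vector_mult_nth: "(M *v x) $ i = (\<Sum>k\<in>UNIV. M $ i $ k * x $ k)"
  by (simp add: matrix_vector_mult_def)

lemma transpose_nth: "transpose M $ i $ j = M $ j $ i"
  by (simp add: transpose_def)

lemma hmat_eq_gram: "hmat ht y z = gram (ht y) z"
proof -
  have "(\<Sum>a\<in>UNIV. \<Sum>b\<in>UNIV. ht y $ a $ b * z $ i $ a * z $ j $ b)
      = (\<Sum>b\<in>UNIV. (\<Sum>a\<in>UNIV. z $ i $ a * ht y $ a $ b) * z $ j $ b)" for i j
    by (subst sum.swap) (simp add: sum_distrib_left sum_distrib_right ac_simps)
  then show ?thesis
    by (simp add: vec_eq_iff hmat_def gram_def matrix_matrix_mult_nth transpose_nth)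
qed

lemma Wtlow_eq: "Wtlow ht Wt y a = (ht y *v Wt y) $ a"
  by (simp add: Wtlow_def matrix_vector_mult_nth)

lemma normWt2_eq: "normWt2 ht Wt y = Wt y \<bullet> (ht y *v Wt y)"
  by (simp add: normWt2_def inner_vec_def matrix_vector_mult_nth sum_distrib_left ac_simps)

lemma Wlow_eq: "Wlow ht Wt y z i = (z *v (ht y *v Wt y)) $ i"
  by (simp add: Wlow_def matrix_vector_mult_nth[of z] Wtlow_eq mult.commute)

lemma sfun_eq_nav_s: "sfun ht Wt y z = nav_s (ht y) (Wt y) z"
  by (simp add: sfun_def nav_s_def normWt2_eq normW2_def Wlow_eq hinv_def hmat_eq_gram tang_vec_def
      inner_vec_def matrix_vector_mult_nth[of "matrix_inv _"] sum_distrib_left ac_simps)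

lemma volF_eq_vol: "volF v ht Wt y z = vol v (ht y) (Wt y) z"
  by (simp add: volF_def vol_def sfun_eq_nav_s normWt2_eq hmat_eq_gram divide_inverse)

subsection \<open>Partial derivatives of the volume density\<close>

text \<open>Up to the factor \<open>V\<close>, the second derivative of the density in the entries
  \<open>(i, g)\<close> and \<open>(j, e)\<close> of \<open>z\<close>. The geometric data are plain
  arguments because two locales with their own abbreviations share it.\<close>

definition hess_coeff ::
  "real \<Rightarrow> real \<Rightarrow> real \<Rightarrow> real^'m^'n \<Rightarrow> real^'n \<Rightarrow> real^'m \<Rightarrow> real^'m^'m \<Rightarrow> real^'n^'n \<Rightarrow>
    'n \<Rightarrow> 'm \<Rightarrow> 'n \<Rightarrow> 'm \<Rightarrow> real" where
  "hess_coeff r r1 r2 A q \<nu> E N i g j e =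
     A $ j $ e * (r * A $ i $ g + 2 * r1 * q $ i * \<nu> $ g)
     + 2 * q $ j * \<nu> $ e * (r1 * A $ i $ g + 2 * r2 * q $ i * \<nu> $ g)
     + r * (N $ i $ j * E $ e $ g - A $ i $ e * A $ j $ g)
     + 2 * r1 * (N $ i $ j * \<nu> $ e - A $ i $ e * q $ j) * \<nu> $ g
     - 2 * r1 * q $ i * (E $ g $ e * q $ j + A $ j $ g * \<nu> $ e)"

text \<open>A second differentiation needs the formula for the first derivative near parameter 0,
  hence nondegeneracy there.\<close>

lemma (in variation) eventually_det_gram_nz: "\<forall>\<^sub>F t in nhds 0. det (gram (H t) (z t)) \<noteq> 0"
proof -
  have "isCont (\<lambda>t. det (gram (H t) (z t))) 0"
    using has_real_derivative_det[OF d_gram] by (rule DERIV_isCont)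
  then show ?thesis
    using nz by (simp add: isCont_def tendsto_imp_eventually_ne eventually_nhds_conv_at)
qed

context vol_variation
begin

text \<open>What is left of \<open>ds\<close> for \<open>u = 0\<close>; the part linear in
  \<open>u\<close> moves into the double sums below.\<close>

definition "ds0 = 2 * (q \<bullet> (z 0 *v c)) - 2 * (W 0 \<bullet> c)"

abbreviation "S \<equiv> hess_coeff r r1 r2 A q \<nu> E N"

lemma d_vol_sum:
  "((\<lambda>t. vol v (H t) (W t) (z t)) has_real_derivative
      V * ((\<Sum>j\<in>UNIV. \<Sum>e\<in>UNIV. (r * A $ j $ e + 2 * r1 * q $ j * \<nu> $ e) * u $ j $ e)
        - 2 * log_chi_deriv v CARD('n) (W 0 \<bullet> (H 0 *v W 0)) * (W 0 \<bullet> c) * r + r1 * ds0)) (at 0)"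
proof -
  have "trace (A ** transpose u) = (\<Sum>j\<in>UNIV. \<Sum>e\<in>UNIV. A $ j $ e * u $ j $ e)"
    by (simp add: trace_def matrix_matrix_mult_nth transpose_nth)
  moreover have "q \<bullet> (u *v \<nu>) = (\<Sum>j\<in>UNIV. \<Sum>e\<in>UNIV. q $ j * u $ j $ e * \<nu> $ e)"
    by (simp add: inner_vec_def matrix_vector_mult_nth sum_distrib_left ac_simps)
  ultimately have "r * trace (A ** transpose u) + 2 * r1 * (q \<bullet> (u *v \<nu>))
      = (\<Sum>j\<in>UNIV. \<Sum>e\<in>UNIV. (r * A $ j $ e + 2 * r1 * q $ j * \<nu> $ e) * u $ j $ e)"
    by (simp add: sum.distrib sum_distrib_left algebra_simps)
  then show ?thesis
    by (intro DERIV_cong[OF d_vol]) (simp add: ds_def ds0_def algebra_simps)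
qed

text \<open>\<open>d_vol_grad\<close> is affine in \<open>u\<close>. Writing its linear part as a
  contraction with the entries of \<open>u\<close> lets the Hessian be read off by choosing
  elementary directions.\<close>

lemma d_vol_grad_sum:
  "((\<lambda>t. vol_grad v (H t) (W t) (z t) g i) has_real_derivative
      V * ((\<Sum>j\<in>UNIV. \<Sum>e\<in>UNIV. S i g j e * u $ j $ e)
        + (\<Sum>d\<in>UNIV. L $ d $ g * (r * A $ i $ d + 2 * r1 * q $ i * \<nu> $ d))
        - 2 * log_chi_deriv v CARD('n) (W 0 \<bullet> (H 0 *v W 0)) * (W 0 \<bullet> c) * (r * A $ i $ g + 2 * r1 * q $ i * \<nu> $ g)
        + ds0 * (r1 * A $ i $ g + 2 * r2 * q $ i * \<nu> $ g)
        + 2 * r1 * ((N *v (z 0 *v c)) $ i * \<nu> $ g + q $ i * (c - transpose \<zeta> *v (N *v (z 0 *v c))) $ g))) (at 0)"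
proof -
  define T where "T X = (\<Sum>j\<in>UNIV. \<Sum>e\<in>UNIV. X j e * u $ j $ e)" for X
  have T_add: "T (\<lambda>j e. X j e + Y j e) = T X + T Y" for X Y
    by (simp add: T_def sum.distrib algebra_simps)
  have T_diff: "T (\<lambda>j e. X j e - Y j e) = T X - T Y" for X Y
    by (simp add: T_def sum_subtractf algebra_simps)
  have T_left: "T (\<lambda>j e. k * X j e) = k * T X" for X k
    by (simp add: T_def sum_distrib_left ac_simps)
  have 1: "trace (A ** transpose u) = T (\<lambda>j e. A $ j $ e)"
    by (simp add: T_def trace_def matrix_matrix_mult_nth transpose_nth)
  have 2: "q \<bullet> (u *v \<nu>) = T (\<lambda>j e. q $ j * \<nu> $ e)"
    by (simp add: T_def inner_vec_def matrix_vector_mult_nth sum_distrib_left ac_simps)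
  have 3: "(N ** u ** E) $ i $ g = T (\<lambda>j e. N $ i $ j * E $ e $ g)"
    unfolding T_def by (subst sum.swap) (simp add: matrix_matrix_mult_nth sum_distrib_right sum_distrib_left ac_simps)
  have 4: "(A ** transpose u ** A) $ i $ g = T (\<lambda>j e. A $ i $ e * A $ j $ g)"
    by (simp add: T_def matrix_matrix_mult_nth transpose_nth sum_distrib_right sum_distrib_left ac_simps)
  have 5: "(N *v (u *v \<nu>)) $ i = T (\<lambda>j e. N $ i $ j * \<nu> $ e)"
    by (simp add: T_def matrix_vector_mult_nth sum_distrib_left ac_simps)
  have 6: "(A *v (transpose u *v q)) $ i = T (\<lambda>j e. A $ i $ e * q $ j)"
    unfolding T_def by (subst sum.swap) (simp add: matrix_vector_mult_nth transpose_nth sum_distrib_left ac_simps)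
  have 7: "(E *v (transpose u *v q)) $ g = T (\<lambda>j e. E $ g $ e * q $ j)"
    unfolding T_def by (subst sum.swap) (simp add: matrix_vector_mult_nth transpose_nth sum_distrib_left ac_simps)
  have 8: "(transpose A *v (u *v \<nu>)) $ g = T (\<lambda>j e. A $ j $ g * \<nu> $ e)"
    by (simp add: T_def matrix_vector_mult_nth transpose_nth sum_distrib_left ac_simps)
  have S: "T (\<lambda>j e. S i g j e) =
      (r * A $ i $ g + 2 * r1 * q $ i * \<nu> $ g) * T (\<lambda>j e. A $ j $ e)
      + 2 * (r1 * A $ i $ g + 2 * r2 * q $ i * \<nu> $ g) * T (\<lambda>j e. q $ j * \<nu> $ e)
      + r * (T (\<lambda>j e. N $ i $ j * E $ e $ g) - T (\<lambda>j e. A $ i $ e * A $ j $ g))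
      + (2 * r1 * \<nu> $ g) * (T (\<lambda>j e. N $ i $ j * \<nu> $ e) - T (\<lambda>j e. A $ i $ e * q $ j))
      - (2 * r1 * q $ i) * (T (\<lambda>j e. E $ g $ e * q $ j) + T (\<lambda>j e. A $ j $ g * \<nu> $ e))"
    unfolding T_add[symmetric] T_diff[symmetric] T_left[symmetric]
    by (simp add: hess_coeff_def algebra_simps)
  have L: "(\<Sum>d\<in>UNIV. L $ d $ g * (r * A $ i $ d + 2 * r1 * q $ i * \<nu> $ d))
      = r * (A ** L) $ i $ g + 2 * r1 * q $ i * (transpose L *v \<nu>) $ g"
    by (simp add: matrix_matrix_mult_nth matrix_vector_mult_nth transpose_nth sum.distrib sum_distrib_left
        algebra_simps)
  show ?thesis
    unfolding L
    by (rule DERIV_cong[OF d_vol_grad], unfold T_def[symmetric] S)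
      (simp add: dA_def dq_def d\<nu>_def ds_def ds0_def 1 2 3 4 5 6 7 8 algebra_simps)
qed

end

lemma sum_mult_axis_axis:
  "(\<Sum>j\<in>UNIV. \<Sum>e\<in>UNIV. X j e * axis i (axis g (1::real)) $ j $ e) = X i g"
proof -
  have "X j e * axis i (axis g (1::real)) $ j $ e = (if e = g then (if j = i then X j e else 0) else 0)" for j e
    by (simp add: axis_def)
  then show ?thesis by (simp add: sum.delta)
qed

lemma det_nz_if_posdef:
  fixes M :: "real^'k^'k"
  assumes "\<And>u. u \<noteq> 0 \<Longrightarrow> u \<bullet> (M *v u) > 0"
  shows "det M \<noteq> 0"
proof -
  have "M *v x = 0 \<Longrightarrow> x = 0" for x
    using assms[of x] by (cases "x = 0") auto
  then show ?thesis
    by (simp add: invertible_det_nz[symmetric] invertible_left_inverse matrix_left_invertible_ker)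
qed

lemma inner_gram: "x \<bullet> (gram H z *v x) = (transpose z *v x) \<bullet> (H *v (transpose z *v x))"
  using inner_matrix_vector_right[of x z "H *v (transpose z *v x)"]
  by (simp add: gram_def matrix_vector_mul_assoc matrix_mul_assoc)

text \<open>The argument \<open>z\<close> supplies the dimension \<open>n\<close> through its type.
  As a constant, this keeps the derivative opaque in algebraic simplification.\<close>

definition log_chi_at :: "volume_kind \<Rightarrow> real^'m^'m \<Rightarrow> real^'m \<Rightarrow> real^'m^'n \<Rightarrow> real" where
  "log_chi_at v H W z = log_chi_deriv v CARD('n) (W \<bullet> (H *v W))"

locale navigation =
  fixes ht :: "real^'m \<Rightarrow> real^'m^'m" and Wt :: "real^'m \<Rightarrow> real^'m" and Ut :: "(real^'m) set"
  assumes Ut: "open Ut"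
    and ht_diff: "\<And>a b. (\<lambda>y. ht y $ a $ b) differentiable_on Ut"
    and ht_sym: "\<And>y. y \<in> Ut \<Longrightarrow> transpose (ht y) = ht y"
    and ht_pos: "\<And>y u. y \<in> Ut \<Longrightarrow> u \<noteq> 0 \<Longrightarrow> u \<bullet> (ht y *v u) > 0"
    and Wt_diff: "\<And>a. (\<lambda>y. Wt y $ a) differentiable_on Ut"
    and Wt_less: "\<And>y. y \<in> Ut \<Longrightarrow> normWt2 ht Wt y < 1"
begin

lemma det_ht: "y \<in> Ut \<Longrightarrow> det (ht y) \<noteq> 0"
  by (rule det_nz_if_posdef) (rule ht_pos)

text \<open>Full rank makes \<open>transpose z\<close> injective, so positive definiteness passes
  from the ambient to the induced metric.\<close>

lemma det_gram:
  fixes z :: "real^'m^'n"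
  assumes "y \<in> Ut" "rank z = CARD('n)"
  shows "det (gram (ht y) z) \<noteq> 0"
proof (rule det_nz_if_posdef)
  fix x :: "real^'n" assume "x \<noteq> 0"
  have "inj ((*v) (transpose z))"
    using assms(2) by (simp add: full_rank_injective[symmetric] rank_transpose)
  then have "transpose z *v x \<noteq> 0"
    using \<open>x \<noteq> 0\<close> by (metis injD matrix_vector_mult_0_right)
  then show "x \<bullet> (gram (ht y) z *v x) > 0"
    unfolding inner_gram by (rule ht_pos[OF assms(1)])
qed

text \<open>The last summand of \<open>nav_s\<close> is the squared length of the tangential part of
  the wind, hence nonnegative. Positivity is what makes the power \<open>rho\<close> differentiable
  there.\<close>

lemma nav_s_pos:
  assumes "y \<in> Ut" "det (gram (ht y) z) \<noteq> 0"
  shows "nav_s (ht y) (Wt y) z > 0"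
proof -
  let ?X = "z *v (ht y *v Wt y)" and ?q = "tang_vec (ht y) (Wt y) z"
  have "?X = gram (ht y) z *v ?q"
    by (simp add: tang_vec_def matrix_vector_mul_assoc[of "gram _ _"] matrix_inv_det_nz[OF assms(2)])
  then have "?X \<bullet> ?q = (transpose z *v ?q) \<bullet> (ht y *v (transpose z *v ?q))"
    by (simp add: inner_commute inner_gram)
  also have "\<dots> \<ge> 0"
    using ht_pos[OF assms(1), of "transpose z *v ?q"] by (cases "transpose z *v ?q = 0") auto
  finally show ?thesis
    using Wt_less[OF assms(1)] by (simp add: nav_s_def normWt2_eq)
qed

lemma eventually_line_in_Ut:
  assumes "y \<in> Ut"
  shows "\<forall>\<^sub>F t in nhds 0. y + t *\<^sub>R axis e (1::real) \<in> Ut"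
proof -
  have "isCont (\<lambda>t. y + t *\<^sub>R axis e (1::real)) 0"
    by (intro continuous_intros)
  then have "((\<lambda>t. y + t *\<^sub>R axis e (1::real)) \<longlongrightarrow> y) (at 0)"
    by (simp add: isCont_def)
  from topological_tendstoD[OF this Ut assms] show ?thesis
    using assms by (simp add: eventually_nhds_conv_at)
qed

lemma ht_nth_sym:
  assumes "y \<in> Ut"
  shows "ht y $ a $ b = ht y $ b $ a"
  using transpose_nth[of "ht y" a b] unfolding ht_sym[OF assms] .

lemma pd_ht_sym:
  assumes "y \<in> Ut"
  shows "pd (\<lambda>y. ht y $ a $ b) e y = pd (\<lambda>y. ht y $ b $ a) e y"
proof -
  have "\<forall>\<^sub>F t in nhds 0. ht (y + t *\<^sub>R axis e 1) $ a $ b = ht (y + t *\<^sub>R axis e 1) $ b $ a"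
    by (rule eventually_mono[OF eventually_line_in_Ut[OF assms]]) (rule ht_nth_sym)
  then show ?thesis
    unfolding pd_def by (intro deriv_cong_ev refl)
qed

section \<open>Levi-Civita connection of the ambient metric\<close>

lemma Gt_sym: "y \<in> Ut \<Longrightarrow> Gt ht y a t d = Gt ht y a d t"
  unfolding Gt_def by (subst pd_ht_sym[of y t d]) (simp_all add: add.commute)

definition christoffel :: "real^'m \<Rightarrow> 'm \<Rightarrow> real^'m^'m" where
  "christoffel y e = (\<chi> a b. Gt ht y a e b)"

lemma christoffel_nth: "christoffel y e $ a $ b = Gt ht y a e b"
  by (simp add: christoffel_def)

lemma ht_christoffel:
  assumes "y \<in> Ut"
  shows "(ht y ** christoffel y e) $ a $ b =
    (pd (\<lambda>y. ht y $ a $ b) e y + pd (\<lambda>y. ht y $ a $ e) b y - pd (\<lambda>y. ht y $ e $ b) a y) / 2"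
proof -
  define K :: "real^'m^'m" where "K = (\<chi> c b. (pd (\<lambda>y. ht y $ c $ b) e y
    + pd (\<lambda>y. ht y $ c $ e) b y - pd (\<lambda>y. ht y $ e $ b) c y) / 2)"
  have "christoffel y e = matrix_inv (ht y) ** K"
    by (simp add: vec_eq_iff christoffel_def Gt_def K_def matrix_matrix_mult_nth sum_distrib_left)
  then have "ht y ** christoffel y e = K"
    by (simp add: matrix_mul_assoc matrix_inv_det_nz det_ht assms)
  then show ?thesis by (simp add: K_def)
qed

text \<open>In the sum with the transpose the two other first derivatives cancel. This makes
  \<open>christoffel y e\<close> an admissible \<open>L\<close> in \<open>variation\<close>.\<close>

lemma metric_compatible:
  assumes "y \<in> Ut"
  shows "(transpose (christoffel y e) ** ht y + ht y ** christoffel y e) $ a $ b = pd (\<lambda>y. ht y $ a $ b) e y"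
proof -
  have "transpose (christoffel y e) ** ht y = transpose (ht y ** christoffel y e)"
    by (simp add: matrix_transpose_mul ht_sym assms)
  then show ?thesis
    by (simp add: transpose_nth ht_christoffel assms)
      (simp add: pd_ht_sym[OF assms, of b a] pd_ht_sym[OF assms, of e a] pd_ht_sym[OF assms, of b e] field_simps)
qed

lemma z_variation:
  assumes "y \<in> Ut" "det (gram (ht y) z) \<noteq> 0"
  shows "vol_variation (\<lambda>t. ht y) (\<lambda>t. Wt y) (\<lambda>t. z + t *\<^sub>R w) 0 0 w"
proof
  show "((\<lambda>t. ht y) has_vector_derivative transpose 0 ** ht y + ht y ** 0) (at 0)"
    by (simp add: bounded_bilinear.zero_left[OF bounded_bilinear_matrix_mult]
        bounded_bilinear.zero_right[OF bounded_bilinear_matrix_mult]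
        linear_0[OF bounded_linear.linear[OF bounded_linear_transpose]])
  show "((\<lambda>t. Wt y) has_vector_derivative 0 - 0 *v Wt y) (at 0)"
    by simp
  show "((\<lambda>t. z + t *\<^sub>R w) has_vector_derivative w - (z + 0 *\<^sub>R w) ** transpose 0) (at 0)"
    by (auto intro!: derivative_eq_intros simp: bounded_bilinear.zero_right[OF bounded_bilinear_matrix_mult]
        linear_0[OF bounded_linear.linear[OF bounded_linear_transpose]])
qed (use assms nav_s_pos Wt_less in \<open>auto simp: ht_sym normWt2_eq\<close>)

text \<open>As \<open>z\<close> is held fixed, its variation \<open>u - z L\<^sup>T\<close> must
  vanish, which forces \<open>u = z L\<^sup>T\<close>. The choice of \<open>C\<close> expresses that
  the partial derivative of the wind is its covariant derivative minus the Christoffel term.\<close>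

lemma x_variation:
  assumes "y \<in> Ut" "det (gram (ht y) z) \<noteq> 0"
  shows "vol_variation (\<lambda>t. ht (y + t *\<^sub>R axis e 1)) (\<lambda>t. Wt (y + t *\<^sub>R axis e 1)) (\<lambda>t. z)
    (christoffel y e) (\<chi> b. Wcov ht Wt y b e) (z ** transpose (christoffel y e))"
proof
  show "((\<lambda>t. ht (y + t *\<^sub>R axis e 1)) has_vector_derivative
      transpose (christoffel y e) ** ht (y + 0 *\<^sub>R axis e 1) + ht (y + 0 *\<^sub>R axis e 1) ** christoffel y e) (at 0)"
    by (rule has_vector_derivative_matrixI)
      (use metric_compatible[OF assms(1), of e] DERIV_pd[OF ht_diff Ut assms(1)] in simp)
  have "pd (\<lambda>y. Wt y $ a) e y = ((\<chi> b. Wcov ht Wt y b e) - christoffel y e *v Wt y) $ a" for a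
    by (simp add: Wcov_def christoffel_def matrix_vector_mult_nth)
  with DERIV_pd[OF Wt_diff Ut assms(1)]
  have "((\<lambda>t. Wt (y + t *\<^sub>R axis e 1) $ a) has_real_derivative
      ((\<chi> b. Wcov ht Wt y b e) - christoffel y e *v Wt y) $ a) (at 0)" for a
    by metis
  then show "((\<lambda>t. Wt (y + t *\<^sub>R axis e 1)) has_vector_derivative
      (\<chi> b. Wcov ht Wt y b e) - christoffel y e *v Wt (y + 0 *\<^sub>R axis e 1)) (at 0)"
    by (intro has_vector_derivative_vecI) (simp add: has_real_derivative_iff_has_vector_derivative)
qed (use assms nav_s_pos Wt_less in \<open>auto simp: ht_sym normWt2_eq\<close>)

lemma pdz_volF:
  assumes "y \<in> Ut" "det (gram (ht y) z) \<noteq> 0"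
  shows "pdz (volF v ht Wt) g i y z = vol_grad v (ht y) (Wt y) z g i"
proof -
  interpret vol_variation "\<lambda>t. ht y" "\<lambda>t. Wt y" "\<lambda>t. z + t *\<^sub>R axis i (axis g 1)" 0 0 "axis i (axis g 1)" v
    by (rule z_variation[OF assms])
  show ?thesis
    unfolding pdz_def volF_eq_vol
    by (rule DERIV_imp_deriv, rule DERIV_cong[OF d_vol_sum])
      (simp add: ds0_def vol_grad_def sum_mult_axis_axis)
qed

lemma pdz_pdz_volF:
  fixes z :: "real^'m^'n"
  assumes "y \<in> Ut" "det (gram (ht y) z) \<noteq> 0"
  shows "pdz (pdz (volF v ht Wt) e j) g i y z = vol_scale v (ht y) (Wt y) z *
    hess_coeff (rho v CARD('n) (nav_s (ht y) (Wt y) z)) (deriv (rho v CARD('n)) (nav_s (ht y) (Wt y) z))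
      (deriv (deriv (rho v CARD('n))) (nav_s (ht y) (Wt y) z))
      (tang_proj (ht y) z) (tang_vec (ht y) (Wt y) z) (normal_covec (ht y) (Wt y) z)
      (normal_metric (ht y) z) (matrix_inv (gram (ht y) z)) j e i g"
proof -
  interpret vol_variation "\<lambda>t. ht y" "\<lambda>t. Wt y" "\<lambda>t. z + t *\<^sub>R axis i (axis g 1)" 0 0 "axis i (axis g 1)" v
    by (rule z_variation[OF assms])
  have "\<forall>\<^sub>F t in nhds 0. pdz (volF v ht Wt) e j y (z + t *\<^sub>R axis i (axis g 1))
      = vol_grad v (ht y) (Wt y) (z + t *\<^sub>R axis i (axis g 1)) e j"
    using eventually_det_gram_nz by (rule eventually_mono) (rule pdz_volF[OF assms(1)])
  then have "pdz (pdz (volF v ht Wt) e j) g i y z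
      = deriv (\<lambda>t. vol_grad v (ht y) (Wt y) (z + t *\<^sub>R axis i (axis g 1)) e j) 0"
    unfolding pdz_def[of "pdz _ _ _"] by (rule deriv_cong_ev) simp
  also have "\<dots> = vol_scale v (ht y) (Wt y) z * S j e i g"
    by (rule DERIV_imp_deriv, rule DERIV_cong[OF d_vol_grad_sum])
      (simp add: ds0_def sum_mult_axis_axis)
  finally show ?thesis by simp
qed

end

locale navigation_point = navigation ht Wt Ut
  for ht :: "real^'m \<Rightarrow> real^'m^'m" and Wt :: "real^'m \<Rightarrow> real^'m" and Ut :: "(real^'m) set" +
  fixes v :: volume_kind and y :: "real^'m" and z :: "real^'m^'n"
  assumes y: "y \<in> Ut" and det_nz: "det (gram (ht y) z) \<noteq> 0"
begin

abbreviation "N \<equiv> matrix_inv (gram (ht y) z)"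
abbreviation "A \<equiv> tang_proj (ht y) z"
abbreviation "q \<equiv> tang_vec (ht y) (Wt y) z"
abbreviation "\<nu> \<equiv> normal_covec (ht y) (Wt y) z"
abbreviation "E \<equiv> normal_metric (ht y) z"
abbreviation "V \<equiv> vol_scale v (ht y) (Wt y) z"
abbreviation "r \<equiv> rho v CARD('n) (nav_s (ht y) (Wt y) z)"
abbreviation "r1 \<equiv> deriv (rho v CARD('n)) (nav_s (ht y) (Wt y) z)"
abbreviation "r2 \<equiv> deriv (deriv (rho v CARD('n))) (nav_s (ht y) (Wt y) z)"
abbreviation "lc \<equiv> log_chi_at v (ht y) (Wt y) z"
abbreviation "S \<equiv> hess_coeff r r1 r2 A q \<nu> E N"
abbreviation "p i g \<equiv> r * A $ i $ g + 2 * r1 * q $ i * \<nu> $ g"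

text \<open>The covector \<open>c\<close> of the variation in the ambient direction
  \<open>e\<close>, by \<open>ht_Wcov\<close>.\<close>

definition cov :: "'m \<Rightarrow> real^'m" where
  "cov e = (\<chi> a. Wcovlow ht Wt y a e)"

definition "ds_cov e = 2 * (q \<bullet> (z *v cov e)) - 2 * (Wt y \<bullet> cov e)"

lemma ht_Wcov: "ht y *v (\<chi> b. Wcov ht Wt y b e) = cov e"
  by (simp add: cov_def vec_eq_iff Wcovlow_def matrix_vector_mult_nth)

lemma mult_christoffel: "(z ** transpose (christoffel y e)) $ j $ d = (\<Sum>b\<in>UNIV. Gt ht y d e b * z $ j $ b)"
  by (simp add: christoffel_nth matrix_matrix_mult_nth transpose_nth mult.commute)

lemma pdx_volF:
  "pdx (volF v ht Wt) e y z = V * ((\<Sum>j\<in>UNIV. \<Sum>d\<in>UNIV. p j d * (\<Sum>b\<in>UNIV. Gt ht y d e b * z $ j $ b))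
     - 2 * lc * (Wt y \<bullet> cov e) * r + r1 * ds_cov e)"
proof -
  interpret var: vol_variation "\<lambda>t. ht (y + t *\<^sub>R axis e 1)" "\<lambda>t. Wt (y + t *\<^sub>R axis e 1)" "\<lambda>t. z"
    "christoffel y e" "\<chi> b. Wcov ht Wt y b e" "z ** transpose (christoffel y e)" v
    by (rule x_variation[OF y det_nz])
  show ?thesis
    unfolding pdx_def volF_eq_vol
    by (rule DERIV_imp_deriv, rule DERIV_cong[OF var.d_vol_sum])
      (simp add: var.ds0_def ds_cov_def mult_christoffel ht_Wcov log_chi_at_def)
qed

text \<open>The second sum is the frame term of the free covector index \<open>g\<close>; contracted
  with \<open>z\<close> it will cancel against the Christoffel term of
  \<open>pdx_volF\<close>.\<close>

lemma pdx_pdz_volF: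
  "pdx (pdz (volF v ht Wt) g i) e y z =
     V * ((\<Sum>j\<in>UNIV. \<Sum>d\<in>UNIV. S i g j d * (\<Sum>b\<in>UNIV. Gt ht y d e b * z $ j $ b))
       + (\<Sum>d\<in>UNIV. Gt ht y d e g * p i d)
       - 2 * lc * (Wt y \<bullet> cov e) * p i g
       + ds_cov e * (r1 * A $ i $ g + 2 * r2 * q $ i * \<nu> $ g)
       + 2 * r1 * ((N *v (z *v cov e)) $ i * \<nu> $ g
           + q $ i * (cov e - transpose (z ** ht y) *v (N *v (z *v cov e))) $ g))"
proof -
  interpret var: vol_variation "\<lambda>t. ht (y + t *\<^sub>R axis e 1)" "\<lambda>t. Wt (y + t *\<^sub>R axis e 1)" "\<lambda>t. z"
    "christoffel y e" "\<chi> b. Wcov ht Wt y b e" "z ** transpose (christoffel y e)" v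
    by (rule x_variation[OF y det_nz])
  have "\<forall>\<^sub>F t in nhds 0. pdz (volF v ht Wt) g i (y + t *\<^sub>R axis e 1) z
      = vol_grad v (ht (y + t *\<^sub>R axis e 1)) (Wt (y + t *\<^sub>R axis e 1)) z g i"
    using eventually_conj[OF eventually_line_in_Ut[OF y, of e] var.eventually_det_gram_nz]
    by (rule eventually_mono) (auto intro: pdz_volF)
  then have "pdx (pdz (volF v ht Wt) g i) e y z
      = deriv (\<lambda>t. vol_grad v (ht (y + t *\<^sub>R axis e 1)) (Wt (y + t *\<^sub>R axis e 1)) z g i) 0"
    unfolding pdx_def by (rule deriv_cong_ev) simp
  also have "\<dots> = V * ((\<Sum>j\<in>UNIV. \<Sum>d\<in>UNIV. S i g j d * (\<Sum>b\<in>UNIV. Gt ht y d e b * z $ j $ b))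
       + (\<Sum>d\<in>UNIV. Gt ht y d e g * p i d)
       - 2 * lc * (Wt y \<bullet> cov e) * p i g
       + ds_cov e * (r1 * A $ i $ g + 2 * r2 * q $ i * \<nu> $ g)
       + 2 * r1 * ((N *v (z *v cov e)) $ i * \<nu> $ g
           + q $ i * (cov e - transpose (z ** ht y) *v (N *v (z *v cov e))) $ g))"
    by (rule DERIV_imp_deriv, rule DERIV_cong[OF var.d_vol_grad_sum])
      (simp add: var.ds0_def ds_cov_def mult_christoffel ht_Wcov log_chi_at_def christoffel_nth)
  finally show ?thesis .
qed

end

subsection \<open>Index identities\<close>

text \<open>Pairing with a symmetric array sees only the symmetric part.\<close>

lemma sum_symmetrize:
  fixes S Q X :: "'i::finite \<Rightarrow> 'i \<Rightarrow> real"
  assumes "\<And>i j. X i j = X j i" "\<And>i j. S i j + S j i = 2 * Q i j"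
  shows "(\<Sum>i\<in>UNIV. \<Sum>j\<in>UNIV. S i j * X i j) = (\<Sum>i\<in>UNIV. \<Sum>j\<in>UNIV. Q i j * X i j)"
proof -
  have "(\<Sum>i\<in>UNIV. \<Sum>j\<in>UNIV. S i j * X i j) = (\<Sum>i\<in>UNIV. \<Sum>j\<in>UNIV. S j i * X i j)"
    by (subst sum.swap) (simp add: assms(1))
  then have "2 * (\<Sum>i\<in>UNIV. \<Sum>j\<in>UNIV. S i j * X i j)
      = (\<Sum>i\<in>UNIV. \<Sum>j\<in>UNIV. S i j * X i j) + (\<Sum>i\<in>UNIV. \<Sum>j\<in>UNIV. S j i * X i j)"
    by simp
  also have "\<dots> = (\<Sum>i\<in>UNIV. \<Sum>j\<in>UNIV. (S i j + S j i) * X i j)"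
    by (simp add: sum.distrib distrib_right)
  also have "\<dots> = 2 * (\<Sum>i\<in>UNIV. \<Sum>j\<in>UNIV. Q i j * X i j)"
    unfolding assms(2) by (simp add: sum_distrib_left ac_simps)
  finally show ?thesis by simp
qed

lemma sum_kron: "(\<Sum>a\<in>UNIV. kron a g * X a) = X (g :: 'a::finite)"
proof -
  have "kron a g * X a = (if a = g then X a else 0)" for a
    by (simp add: kron_def)
  then show ?thesis by simp
qed

context navigation_point
begin

abbreviation "T \<equiv> transpose z *v q"
abbreviation "BU \<equiv> Bup ht y z"
abbreviation "D a b \<equiv> kron a b - Bmix ht y z a b"

lemma sym_N: "transpose N = N"
  by (rule transpose_matrix_inv[OF _ det_nz]) (simp add: gram_def ht_sym[OF y] matrix_bilinear_simps)

lemma N_nth_sym: "N $ i $ j = N $ j $ i"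
  using transpose_nth[of N i j] unfolding sym_N .

lemma E_nth_sym: "E $ a $ b = E $ b $ a"
proof -
  have "transpose E = E"
    by (simp add: normal_metric_def matrix_bilinear_simps ht_sym[OF y] sym_N)
  then show ?thesis
    using transpose_nth[of E a b] by simp
qed

lemma Bup_eq: "BU a b = (transpose z ** N ** z) $ a $ b"
  unfolding Bup_def hinv_def hmat_eq_gram
  by (subst sum.swap) (simp add: matrix_matrix_mult_nth transpose_nth sum_distrib_right sum_distrib_left ac_simps)

lemma Bmix_eq: "Bmix ht y z a b = (transpose z ** N ** z ** ht y) $ a $ b"
  by (simp add: Bmix_def Bup_eq matrix_matrix_mult_nth[of _ "ht y"])

lemma Blow_eq: "Blow ht y z a b = (ht y ** (transpose z ** N ** z ** ht y)) $ a $ b"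
  by (simp add: Blow_def Bmix_eq matrix_matrix_mult_nth[of "ht y"])

lemma Hl_minus_Blow: "ht y $ a $ b - Blow ht y z a b = E $ a $ b"
  by (simp add: Blow_eq normal_metric_def matrix_bilinear_simps ht_sym[OF y])

lemma sum_Amat: "(\<Sum>d\<in>UNIV. Wtlow ht Wt y d * Amat ht y z i d) = q $ i"
proof -
  have "Amat ht y z i d = (N ** z) $ i $ d" for d
    by (simp add: Amat_def hinv_def hmat_eq_gram matrix_matrix_mult_nth)
  then have "(\<Sum>d\<in>UNIV. Wtlow ht Wt y d * Amat ht y z i d) = ((N ** z) *v (ht y *v Wt y)) $ i"
    by (simp add: Wtlow_eq matrix_vector_mult_nth[of "N ** z"] mult.commute)
  then show ?thesis
    by (simp add: tang_vec_def matrix_bilinear_simps)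
qed

lemma sum_z_A: "(\<Sum>i\<in>UNIV. z $ i $ e * A $ i $ g) = Bmix ht y z e g"
proof -
  have "(\<Sum>i\<in>UNIV. z $ i $ e * A $ i $ g) = (transpose z ** A) $ e $ g"
    by (simp add: matrix_matrix_mult_nth transpose_nth)
  then show ?thesis
    by (simp add: Bmix_eq tang_proj_def matrix_bilinear_simps)
qed

lemma sum_z_mult: "(\<Sum>i\<in>UNIV. z $ i $ e * x $ i) = (transpose z *v x) $ e"
  by (simp add: matrix_vector_mult_nth transpose_nth)

lemma sum_Bup_mult: "(\<Sum>a\<in>UNIV. BU e a * x $ a) = (transpose z *v (N *v (z *v x))) $ e"
  by (simp add: Bup_eq matrix_vector_mult_nth[of "transpose z ** N ** z", symmetric] matrix_bilinear_simps)

lemma sum_Bup_W: "(\<Sum>d\<in>UNIV. BU e d * Wtlow ht Wt y d) = T $ e"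
  by (simp add: Wtlow_eq sum_Bup_mult tang_vec_def)

text \<open>Contraction with the first index of \<open>D\<close> projects a covector to its normal
  part.\<close>

lemma sum_D_mult: "(\<Sum>a\<in>UNIV. D a g * x $ a) = (x - transpose (z ** ht y) *v (N *v (z *v x))) $ g"
proof -
  have tr: "transpose (transpose z ** N ** z ** ht y) = transpose (z ** ht y) ** N ** z"
    by (simp add: matrix_bilinear_simps ht_sym[OF y] sym_N)
  have "Bmix ht y z a g = (transpose (z ** ht y) ** N ** z) $ g $ a" for a
    unfolding tr[symmetric] transpose_nth Bmix_eq ..
  then have "(\<Sum>a\<in>UNIV. Bmix ht y z a g * x $ a) = (transpose (z ** ht y) *v (N *v (z *v x))) $ g"
    by (simp only: matrix_vector_mul_assoc matrix_vector_mult_nth[of "_ ** z"] matrix_mul_assoc)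
  then show ?thesis
    by (simp add: left_diff_distrib sum_subtractf sum_kron)
qed

lemma sum_D_W: "(\<Sum>t\<in>UNIV. D t g * Wtlow ht Wt y t) = \<nu> $ g"
  by (simp only: Wtlow_eq sum_D_mult) (simp add: normal_covec_def tang_vec_def)

lemma sum_Hu_Bup_W:
  "(\<Sum>d\<in>UNIV. (matrix_inv (ht y) $ a $ d - BU a d) * Wtlow ht Wt y d) = Wt y $ a - T $ a"
proof -
  have "(\<Sum>d\<in>UNIV. matrix_inv (ht y) $ a $ d * Wtlow ht Wt y d) = Wt y $ a"
    by (simp add: Wtlow_eq matrix_vector_mult_nth[of "matrix_inv _", symmetric] matrix_vector_mul_assoc
        matrix_inv_det_nz det_ht y)
  then show ?thesis
    by (simp add: left_diff_distrib sum_subtractf sum_Bup_W)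
qed

text \<open>\<open>nav_s\<close> is 1 minus the squared length of the normal part
  \<open>Wt y - T\<close> of the wind, so only this part meets the covariant derivative.\<close>

lemma ds_cov_eq: "ds_cov e = - 2 * (\<Sum>a\<in>UNIV. (Wt y $ a - T $ a) * cov e $ a)"
proof -
  have "(\<Sum>a\<in>UNIV. (Wt y $ a - T $ a) * cov e $ a) = (Wt y - T) \<bullet> cov e"
    by (simp add: inner_vec_def)
  then show ?thesis
    using inner_matrix_vector_right[of q z "cov e"] by (simp add: ds_cov_def inner_diff_left)
qed

lemma normal_covec_tangent: "(\<Sum>e\<in>UNIV. \<nu> $ e * z $ k $ e) = 0"
proof -
  have "z *v \<nu> = z *v (ht y *v Wt y) - gram (ht y) z *v (N *v (z *v (ht y *v Wt y)))"
    by (simp add: normal_covec_def tang_vec_def gram_def matrix_bilinear_simps ht_sym[OF y])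
  also have "\<dots> = 0"
    by (simp only: matrix_vector_mul_assoc[of "gram _ _"] matrix_inv_det_nz[OF det_nz] matrix_vector_mul_lid diff_self)
  finally have "(z *v \<nu>) $ k = 0" by simp
  then show ?thesis by (simp add: matrix_vector_mult_nth mult.commute)
qed

lemma normal_metric_tangent: "(\<Sum>e\<in>UNIV. E $ g $ e * z $ k $ e) = 0"
proof -
  have "E ** transpose z = ht y ** transpose z - (ht y ** transpose z) ** (N ** gram (ht y) z)"
    by (simp add: normal_metric_def gram_def matrix_bilinear_simps ht_sym[OF y])
  also have "\<dots> = 0"
    by (simp only: matrix_inv_det_nz[OF det_nz] matrix_mul_rid diff_self)
  finally have "(E ** transpose z) $ g $ k = 0" by simp
  then show ?thesis by (simp add: matrix_matrix_mult_nth transpose_nth)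
qed

text \<open>The factor of \<open>\<tau>\<close> in the last brace of the theorem, with the
  contractions carried out.\<close>

definition tau_coeff :: "'n \<Rightarrow> 'n \<Rightarrow> 'm \<Rightarrow> 'm \<Rightarrow> real" where
  "tau_coeff i j g e = N $ i $ j * (2 * r1 * (\<nu> $ e * \<nu> $ g) + r * E $ g $ e)
     + 2 * (q $ i * q $ j) * (2 * r2 * (\<nu> $ e * \<nu> $ g) - r1 * E $ g $ e)"

text \<open>The joint factor of the covariant derivative in the first two terms of the theorem,
  multiplied by \<open>r\<close>.\<close>

definition cov_coeff :: "'m \<Rightarrow> 'm \<Rightarrow> 'm \<Rightarrow> real" where
  "cov_coeff g e a = 2 * lc * (2 * r1 * (T $ e * \<nu> $ g) - r * D e g) * Wt y $ a
     - (2 * r1 * ((Wt y $ a - T $ a) * D e g + BU e a * \<nu> $ g)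
        - 2 * T $ e * (2 * r2 * ((Wt y $ a - T $ a) * \<nu> $ g) - r1 * D a g))"

text \<open>All terms of \<open>hess_coeff\<close> containing \<open>A\<close> combine to
  expressions antisymmetric in \<open>(i, j)\<close> and drop out; the rest is symmetric in
  \<open>(i, j)\<close> and in \<open>(g, e)\<close>.\<close>

lemma hess_coeff_symmetrize:
  "S i g j e + S j g i e = 2 * tau_coeff i j g e" "S j e i g + S i e j g = 2 * tau_coeff i j g e"
  using N_nth_sym[of i j] E_nth_sym[of e g] by (simp_all add: hess_coeff_def tau_coeff_def algebra_simps)

text \<open>Every term carries the index \<open>e\<close> on \<open>\<nu>\<close> or
  \<open>E\<close>, and both vanish on the rows of \<open>z\<close>.\<close>

lemma tau_coeff_tangent: "(\<Sum>e\<in>UNIV. tau_coeff i j g e * (\<Sum>k\<in>UNIV. X k * z $ k $ e)) = 0"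
proof -
  have "(\<Sum>e\<in>UNIV. tau_coeff i j g e * z $ k $ e) =
      (2 * r1 * N $ i $ j * \<nu> $ g + 4 * r2 * q $ i * q $ j * \<nu> $ g) * (\<Sum>e\<in>UNIV. \<nu> $ e * z $ k $ e)
      + (r * N $ i $ j - 2 * r1 * q $ i * q $ j) * (\<Sum>e\<in>UNIV. E $ g $ e * z $ k $ e)" for k
    by (simp add: tau_coeff_def sum_distrib_left sum.distrib sum_subtractf algebra_simps)
  then have 0: "(\<Sum>e\<in>UNIV. tau_coeff i j g e * z $ k $ e) = 0" for k
    by (simp only: normal_covec_tangent normal_metric_tangent)
  have "(\<Sum>e\<in>UNIV. tau_coeff i j g e * (\<Sum>k\<in>UNIV. X k * z $ k $ e))
      = (\<Sum>k\<in>UNIV. X k * (\<Sum>e\<in>UNIV. tau_coeff i j g e * z $ k $ e))"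
    unfolding sum_distrib_left by (subst sum.swap) (simp add: ac_simps)
  then show ?thesis by (simp add: 0)
qed

text \<open>Contraction with \<open>z\<close> turns \<open>A\<close> into \<open>Bmix\<close>,
  \<open>q\<close> into \<open>T\<close> and \<open>N *v (z *v cov e)\<close> into a contraction
  with \<open>BU\<close>. The terms at index \<open>g\<close> supply the \<open>kron\<close> that
  completes \<open>Bmix\<close> to \<open>D\<close>.\<close>

lemma cov_terms:
  "(\<Sum>e\<in>UNIV. \<Sum>i\<in>UNIV. (- 2 * lc * (Wt y \<bullet> cov e) * p i g
       + ds_cov e * (r1 * A $ i $ g + 2 * r2 * q $ i * \<nu> $ g)
       + 2 * r1 * ((N *v (z *v cov e)) $ i * \<nu> $ g
           + q $ i * (cov e - transpose (z ** ht y) *v (N *v (z *v cov e))) $ g)) * z $ i $ e)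
   = - 2 * lc * (Wt y \<bullet> cov g) * r + r1 * ds_cov g
     - (\<Sum>e\<in>UNIV. \<Sum>a\<in>UNIV. cov_coeff g e a * cov e $ a)"
proof -
  define \<omega> where "\<omega> e = Wt y \<bullet> cov e" for e
  define \<beta> where "\<beta> e = (\<Sum>a\<in>UNIV. BU e a * cov e $ a)" for e
  define \<delta> where "\<delta> e = (\<Sum>a\<in>UNIV. D a g * cov e $ a)" for e
  have lhs: "(\<Sum>i\<in>UNIV. (- 2 * lc * (Wt y \<bullet> cov e) * p i g
       + ds_cov e * (r1 * A $ i $ g + 2 * r2 * q $ i * \<nu> $ g)
       + 2 * r1 * ((N *v (z *v cov e)) $ i * \<nu> $ g
           + q $ i * (cov e - transpose (z ** ht y) *v (N *v (z *v cov e))) $ g)) * z $ i $ e)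
     = - 2 * lc * \<omega> e * (r * Bmix ht y z e g + 2 * r1 * T $ e * \<nu> $ g)
       + ds_cov e * (r1 * Bmix ht y z e g + 2 * r2 * T $ e * \<nu> $ g)
       + 2 * r1 * (\<beta> e * \<nu> $ g + T $ e * \<delta> e)" for e
    unfolding sum_D_mult[symmetric] \<delta>_def[symmetric] \<omega>_def[symmetric]
    unfolding \<beta>_def sum_Bup_mult sum_z_A[symmetric] sum_z_mult[symmetric]
    by (simp add: sum_distrib_left sum_distrib_right sum.distrib sum_subtractf sum_negf algebra_simps)
  have rhs: "(\<Sum>a\<in>UNIV. cov_coeff g e a * cov e $ a)
     = 2 * lc * (2 * r1 * (T $ e * \<nu> $ g) - r * D e g) * \<omega> e
       + r1 * D e g * ds_cov e - 2 * r1 * \<nu> $ g * \<beta> e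
       - 2 * r2 * T $ e * \<nu> $ g * ds_cov e - 2 * r1 * T $ e * \<delta> e" for e
  proof -
    have "(\<Sum>a\<in>UNIV. cov_coeff g e a * cov e $ a)
     = 2 * lc * (2 * r1 * (T $ e * \<nu> $ g) - r * D e g) * (\<Sum>a\<in>UNIV. Wt y $ a * cov e $ a)
       - 2 * r1 * D e g * (\<Sum>a\<in>UNIV. (Wt y $ a - T $ a) * cov e $ a)
       - 2 * r1 * \<nu> $ g * \<beta> e
       + 4 * r2 * T $ e * \<nu> $ g * (\<Sum>a\<in>UNIV. (Wt y $ a - T $ a) * cov e $ a)
       - 2 * r1 * T $ e * \<delta> e"
      unfolding \<beta>_def \<delta>_def sum_distrib_left sum.distrib[symmetric] sum_subtractf[symmetric]
      by (rule sum.cong[OF refl]) (simp add: cov_coeff_def algebra_simps)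
    then show ?thesis
      by (simp add: ds_cov_eq \<omega>_def inner_vec_def)
  qed
  \<comment> \<open>Spreads the terms at index \<open>g\<close> over a sum in \<open>e\<close>, so
    that both sides agree summand by summand.\<close>
  have k: "X g = (\<Sum>e\<in>UNIV. kron e g * X e)" for X :: "'m \<Rightarrow> real"
    by (simp add: sum_kron)
  have "- 2 * lc * (Wt y \<bullet> cov g) * r + r1 * ds_cov g
      = (\<Sum>e\<in>UNIV. kron e g * (- 2 * lc * \<omega> e * r + r1 * ds_cov e))"
    by (subst k[symmetric]) (simp add: \<omega>_def)
  then show ?thesis
    unfolding lhs rhs by (simp only: sum_subtractf[symmetric]) (rule sum.cong[OF refl], simp add: algebra_simps)
qed

text \<open>Torsion-freeness: symmetry of the lower indices of \<open>Gt\<close> equates the two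
  frame terms, which then cancel.\<close>

lemma sum_christoffel_vol_grad:
  "(\<Sum>j\<in>UNIV. \<Sum>d\<in>UNIV. p j d * (\<Sum>b\<in>UNIV. Gt ht y d g b * z $ j $ b))
     = (\<Sum>e\<in>UNIV. \<Sum>i\<in>UNIV. (\<Sum>d\<in>UNIV. Gt ht y d e g * p i d) * z $ i $ e)"
proof -
  have "(\<Sum>d\<in>UNIV. p j d * (\<Sum>b\<in>UNIV. Gt ht y d g b * z $ j $ b))
      = (\<Sum>e\<in>UNIV. (\<Sum>d\<in>UNIV. Gt ht y d e g * p j d) * z $ j $ e)" for j
    unfolding sum_distrib_left sum_distrib_right
    by (subst sum.swap) (simp add: Gt_sym[OF y, of _ g] ac_simps)
  then show ?thesis
    by (simp only:) (rule sum.swap)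
qed

text \<open>The ambient Christoffel part of the second fundamental form, with \<open>i\<close> and
  \<open>j\<close> exchanged; \<open>quad_christoffel_sym\<close> makes the exchange
  harmless.\<close>

definition quad_christoffel :: "'m \<Rightarrow> 'n \<Rightarrow> 'n \<Rightarrow> real" where
  "quad_christoffel d i j = (\<Sum>e\<in>UNIV. \<Sum>b\<in>UNIV. Gt ht y d e b * z $ i $ e * z $ j $ b)"

lemma quad_christoffel_sym: "quad_christoffel d i j = quad_christoffel d j i"
  unfolding quad_christoffel_def
  by (subst sum.swap) (simp add: Gt_sym[OF y, of d] ac_simps)

lemma sum_christoffel_hess_coeff:
  "(\<Sum>e\<in>UNIV. \<Sum>i\<in>UNIV. (\<Sum>j\<in>UNIV. \<Sum>d\<in>UNIV. S i g j d * (\<Sum>b\<in>UNIV. Gt ht y d e b * z $ j $ b)) * z $ i $ e)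
     = (\<Sum>d\<in>UNIV. \<Sum>i\<in>UNIV. \<Sum>j\<in>UNIV. S i g j d * quad_christoffel d i j)"
proof -
  have inner: "(\<Sum>e\<in>UNIV. (\<Sum>j\<in>UNIV. \<Sum>d\<in>UNIV. S i g j d * (\<Sum>b\<in>UNIV. Gt ht y d e b * z $ j $ b)) * z $ i $ e)
      = (\<Sum>d\<in>UNIV. \<Sum>j\<in>UNIV. S i g j d * quad_christoffel d i j)" for i
  proof -
    have "(\<Sum>e\<in>UNIV. (\<Sum>j\<in>UNIV. \<Sum>d\<in>UNIV. S i g j d * (\<Sum>b\<in>UNIV. Gt ht y d e b * z $ j $ b)) * z $ i $ e)
        = (\<Sum>j\<in>UNIV. \<Sum>e\<in>UNIV. \<Sum>d\<in>UNIV. S i g j d * (\<Sum>b\<in>UNIV. Gt ht y d e b * z $ j $ b) * z $ i $ e)"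
      unfolding sum_distrib_right by (rule sum.swap)
    also have "\<dots> = (\<Sum>j\<in>UNIV. \<Sum>d\<in>UNIV. \<Sum>e\<in>UNIV. S i g j d * (\<Sum>b\<in>UNIV. Gt ht y d e b * z $ j $ b) * z $ i $ e)"
      by (rule sum.cong[OF refl]) (rule sum.swap)
    also have "\<dots> = (\<Sum>j\<in>UNIV. \<Sum>d\<in>UNIV. S i g j d * quad_christoffel d i j)"
      unfolding quad_christoffel_def sum_distrib_left sum_distrib_right by (simp add: ac_simps)
    also have "\<dots> = (\<Sum>d\<in>UNIV. \<Sum>j\<in>UNIV. S i g j d * quad_christoffel d i j)"
      by (rule sum.swap)
    finally show ?thesis .
  qed
  show ?thesis
    by (subst sum.swap, simp only: inner) (rule sum.swap)
qed

text \<open>The coefficients of the second fundamental form arise by symmetrising the Hessian of the volume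
  density in \<open>(i, j)\<close>. They annihilate tangent vectors, so the Christoffel symbols \<open>\<Gamma>\<close> of the induced
  metric may be arbitrary numbers here.\<close>

lemma euler_lagrange_volF:
  fixes Hess :: "'m \<Rightarrow> 'n \<Rightarrow> 'n \<Rightarrow> real" and \<Gamma> :: "'n \<Rightarrow> 'n \<Rightarrow> 'n \<Rightarrow> real"
  assumes Hess_sym: "\<And>e i j. Hess e i j = Hess e j i"
  shows "1 / volF v ht Wt y z *
      (pdx (volF v ht Wt) g y z
       - (\<Sum>e\<in>UNIV. \<Sum>i\<in>UNIV. \<Sum>j\<in>UNIV. pdz (pdz (volF v ht Wt) e j) g i y z * Hess e i j)
       - (\<Sum>e\<in>UNIV. \<Sum>i\<in>UNIV. pdx (pdz (volF v ht Wt) g i) e y z * z $ i $ e))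
    = 1 / r * ((\<Sum>e\<in>UNIV. \<Sum>a\<in>UNIV. cov_coeff g e a * cov e $ a)
       - (\<Sum>i\<in>UNIV. \<Sum>j\<in>UNIV. \<Sum>e\<in>UNIV. tau_coeff i j g e *
           (Hess e i j + (\<Sum>t\<in>UNIV. \<Sum>d\<in>UNIV. Gt ht y e t d * z $ j $ t * z $ i $ d)
            - (\<Sum>k\<in>UNIV. \<Gamma> k i j * z $ k $ e))))"
proof -
  have s: "nav_s (ht y) (Wt y) z > 0" by (rule nav_s_pos[OF y det_nz])
  have r: "r > 0" by (rule rho_pos[OF s])
  have "chi v CARD('n) (Wt y \<bullet> (ht y *v Wt y)) > 0"
    using Wt_less[OF y] by (intro chi_pos) (simp add: normWt2_eq)
  then have V: "V \<noteq> 0" using det_nz by (simp add: vol_scale_def)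
  have vol: "volF v ht Wt y z = V * r"
    by (simp add: volF_eq_vol vol_def vol_scale_def)
  have swap: "(\<Sum>e\<in>UNIV. \<Sum>i\<in>UNIV. \<Sum>j\<in>UNIV. X e i j) = (\<Sum>i\<in>UNIV. \<Sum>j\<in>UNIV. \<Sum>e\<in>UNIV. X e i j)"
    for X :: "'m \<Rightarrow> 'n \<Rightarrow> 'n \<Rightarrow> real"
    by (subst sum.swap, rule sum.cong[OF refl]) (rule sum.swap)
  \<comment> \<open>The Hessian of the density is paired once with second derivatives of the
    immersion and once, in \<open>Y\<close>, with Christoffel terms. Both arrays are symmetric, so
    both pairings reduce to \<open>tau_coeff\<close>.\<close>
  have hess: "(\<Sum>e\<in>UNIV. \<Sum>i\<in>UNIV. \<Sum>j\<in>UNIV. S j e i g * Hess e i j)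
      = (\<Sum>i\<in>UNIV. \<Sum>j\<in>UNIV. \<Sum>e\<in>UNIV. tau_coeff i j g e * Hess e i j)"
    unfolding swap[symmetric]
    by (intro sum.cong[OF refl] sum_symmetrize Hess_sym) (rule hess_coeff_symmetrize)
  have Y: "(\<Sum>d\<in>UNIV. \<Sum>i\<in>UNIV. \<Sum>j\<in>UNIV. S i g j d * quad_christoffel d i j)
      = (\<Sum>i\<in>UNIV. \<Sum>j\<in>UNIV. \<Sum>e\<in>UNIV. tau_coeff i j g e * quad_christoffel e i j)"
    unfolding swap[symmetric]
    by (intro sum.cong[OF refl] sum_symmetrize quad_christoffel_sym) (rule hess_coeff_symmetrize)
  have quad: "(\<Sum>t\<in>UNIV. \<Sum>d\<in>UNIV. Gt ht y e t d * z $ j $ t * z $ i $ d) = quad_christoffel e i j" for e i j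
    by (rule trans[OF quad_christoffel_def[symmetric] quad_christoffel_sym])
  have tau: "(\<Sum>i\<in>UNIV. \<Sum>j\<in>UNIV. \<Sum>e\<in>UNIV. tau_coeff i j g e *
           (Hess e i j + (\<Sum>t\<in>UNIV. \<Sum>d\<in>UNIV. Gt ht y e t d * z $ j $ t * z $ i $ d)
            - (\<Sum>k\<in>UNIV. \<Gamma> k i j * z $ k $ e)))
      = (\<Sum>i\<in>UNIV. \<Sum>j\<in>UNIV. \<Sum>e\<in>UNIV. tau_coeff i j g e * Hess e i j)
        + (\<Sum>i\<in>UNIV. \<Sum>j\<in>UNIV. \<Sum>e\<in>UNIV. tau_coeff i j g e * quad_christoffel e i j)"
    unfolding quad
    by (simp add: right_diff_distrib distrib_left sum.distrib sum_subtractf tau_coeff_tangent)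
  let ?c = "\<lambda>e i. - 2 * lc * (Wt y \<bullet> cov e) * p i g
       + ds_cov e * (r1 * A $ i $ g + 2 * r2 * q $ i * \<nu> $ g)
       + 2 * r1 * ((N *v (z *v cov e)) $ i * \<nu> $ g
           + q $ i * (cov e - transpose (z ** ht y) *v (N *v (z *v cov e))) $ g)"
  have "pdx (pdz (volF v ht Wt) g i) e y z * z $ i $ e =
      V * ((\<Sum>j\<in>UNIV. \<Sum>d\<in>UNIV. S i g j d * (\<Sum>b\<in>UNIV. Gt ht y d e b * z $ j $ b)) * z $ i $ e
        + (\<Sum>d\<in>UNIV. Gt ht y d e g * p i d) * z $ i $ e + ?c e i * z $ i $ e)" for e i
    unfolding pdx_pdz_volF
    by (simp only: distrib_right distrib_left left_diff_distrib right_diff_distrib mult_minus_left)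
  then have xz: "(\<Sum>e\<in>UNIV. \<Sum>i\<in>UNIV. pdx (pdz (volF v ht Wt) g i) e y z * z $ i $ e)
      = V * ((\<Sum>e\<in>UNIV. \<Sum>i\<in>UNIV. (\<Sum>j\<in>UNIV. \<Sum>d\<in>UNIV. S i g j d * (\<Sum>b\<in>UNIV. Gt ht y d e b * z $ j $ b)) * z $ i $ e)
        + (\<Sum>e\<in>UNIV. \<Sum>i\<in>UNIV. (\<Sum>d\<in>UNIV. Gt ht y d e g * p i d) * z $ i $ e)
        + (\<Sum>e\<in>UNIV. \<Sum>i\<in>UNIV. ?c e i * z $ i $ e))"
    by (simp only: sum.distrib[symmetric] sum_distrib_left)
  have zz: "(\<Sum>e\<in>UNIV. \<Sum>i\<in>UNIV. \<Sum>j\<in>UNIV. pdz (pdz (volF v ht Wt) e j) g i y z * Hess e i j)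
      = V * (\<Sum>i\<in>UNIV. \<Sum>j\<in>UNIV. \<Sum>e\<in>UNIV. tau_coeff i j g e * Hess e i j)"
    unfolding hess[symmetric] by (simp only: pdz_pdz_volF[OF y det_nz] sum_distrib_left mult.assoc)
  show ?thesis
    unfolding tau zz xz pdx_volF vol sum_christoffel_hess_coeff Y sum_christoffel_vol_grad cov_terms
    using V r by (simp add: field_simps)
qed

text \<open>Purely algebraic: the double sums with the lowered wind factor into products of
  \<open>T\<close>, \<open>\<nu>\<close>, \<open>q\<close> and \<open>Wt y - T\<close>. The array
  \<open>tau\<close> is arbitrary.\<close>

lemma formula_coeffs:
  defines "Wl \<equiv> Wtlow ht Wt y" and "Wc \<equiv> Wcovlow ht Wt y"
  shows "(2 * lc / r) * (\<Sum>e\<in>UNIV. \<Sum>a\<in>UNIV.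
           (2 * r1 * (\<Sum>d\<in>UNIV. \<Sum>t\<in>UNIV. BU e d * Wl d * Wl t * D t g) - r * D e g)
           * Wc a e * Wt y $ a)
     - (1 / r) * (\<Sum>a\<in>UNIV. \<Sum>b\<in>UNIV. \<Sum>e\<in>UNIV.
           (2 * r1 * ((matrix_inv (ht y) $ a $ b - BU a b) * D e g + BU e a * D b g)
            - 2 * BU e b * (2 * r2 * (\<Sum>d\<in>UNIV. \<Sum>t\<in>UNIV. (matrix_inv (ht y) $ a $ d - BU a d) * Wl d * Wl t * D t g)
                            - r1 * D a g))
           * Wc a e * Wl b)
     - (1 / r) * (\<Sum>i\<in>UNIV. \<Sum>j\<in>UNIV. \<Sum>e\<in>UNIV.
           (hinv ht y z $ i $ j * (2 * r1 * (\<Sum>a\<in>UNIV. \<Sum>b\<in>UNIV. Wl a * Wl b * D a e * D b g)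
              + r * (ht y $ g $ e - Blow ht y z g e))
            + 2 * (\<Sum>d\<in>UNIV. \<Sum>t\<in>UNIV. Wl d * Wl t * Amat ht y z i d * Amat ht y z j t)
                * (2 * r2 * (\<Sum>a\<in>UNIV. \<Sum>b\<in>UNIV. Wl a * Wl b * D a e * D b g)
                   - r1 * (ht y $ g $ e - Blow ht y z g e)))
           * tau e i j)
    = 1 / r * ((\<Sum>e\<in>UNIV. \<Sum>a\<in>UNIV. cov_coeff g e a * cov e $ a)
       - (\<Sum>i\<in>UNIV. \<Sum>j\<in>UNIV. \<Sum>e\<in>UNIV. tau_coeff i j g e * tau e i j))"
proof -
  have s1: "(\<Sum>d\<in>UNIV. \<Sum>t\<in>UNIV. BU e d * Wl d * Wl t * D t g) = T $ e * \<nu> $ g" for e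
    unfolding sum_Bup_W[symmetric] sum_D_W[symmetric] Wl_def sum_product by (simp only: ac_simps)
  have s2: "(\<Sum>d\<in>UNIV. \<Sum>t\<in>UNIV. (matrix_inv (ht y) $ a $ d - BU a d) * Wl d * Wl t * D t g)
      = (Wt y $ a - T $ a) * \<nu> $ g" for a
    unfolding sum_Hu_Bup_W[symmetric] sum_D_W[symmetric] Wl_def sum_product by (simp only: ac_simps)
  have s3: "(\<Sum>a\<in>UNIV. \<Sum>b\<in>UNIV. Wl a * Wl b * D a e * D b g) = \<nu> $ e * \<nu> $ g" for e
    unfolding sum_D_W[symmetric] Wl_def sum_product by (simp only: ac_simps)
  have s4: "(\<Sum>d\<in>UNIV. \<Sum>t\<in>UNIV. Wl d * Wl t * Amat ht y z i d * Amat ht y z j t) = q $ i * q $ j" for i j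
    unfolding sum_Amat[symmetric] Wl_def sum_product by (simp only: ac_simps)
  \<comment> \<open>Carries out the sum over \<open>b\<close> in the second term of the theorem;
    \<open>X\<close> stands for the bracket free of \<open>b\<close>.\<close>
  have s5: "(\<Sum>b\<in>UNIV. \<Sum>e\<in>UNIV. (2 * r1 * ((matrix_inv (ht y) $ a $ b - BU a b) * D e g + BU e a * D b g)
            - 2 * BU e b * X) * Wc a e * Wl b)
      = (\<Sum>e\<in>UNIV. (2 * r1 * ((Wt y $ a - T $ a) * D e g + BU e a * \<nu> $ g) - 2 * T $ e * X) * Wc a e)" for a X
  proof -
    have inner: "(\<Sum>b\<in>UNIV. (2 * r1 * ((matrix_inv (ht y) $ a $ b - BU a b) * D e g + BU e a * D b g)
            - 2 * BU e b * X) * Wc a e * Wl b)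
        = 2 * r1 * D e g * Wc a e * (\<Sum>b\<in>UNIV. (matrix_inv (ht y) $ a $ b - BU a b) * Wl b)
          + 2 * r1 * BU e a * Wc a e * (\<Sum>b\<in>UNIV. D b g * Wl b)
          - 2 * X * Wc a e * (\<Sum>b\<in>UNIV. BU e b * Wl b)" for e
      unfolding sum_distrib_left sum.distrib[symmetric] sum_subtractf[symmetric]
      by (rule sum.cong[OF refl]) (simp add: algebra_simps)
    show ?thesis
      by (subst sum.swap, rule sum.cong[OF refl],
          unfold inner, unfold Wl_def sum_Hu_Bup_W sum_D_W sum_Bup_W) (simp add: algebra_simps)
  qed
  have N: "hinv ht y z = N" by (simp add: hinv_def hmat_eq_gram)
  have cov: "Wc a e = cov e $ a" for a e by (simp add: Wc_def cov_def)
  have "(\<Sum>e\<in>UNIV. \<Sum>a\<in>UNIV. cov_coeff g e a * cov e $ a)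
      = 2 * lc * (\<Sum>e\<in>UNIV. \<Sum>a\<in>UNIV. (2 * r1 * (T $ e * \<nu> $ g) - r * D e g) * Wc a e * Wt y $ a)
        - (\<Sum>a\<in>UNIV. \<Sum>e\<in>UNIV. (2 * r1 * ((Wt y $ a - T $ a) * D e g + BU e a * \<nu> $ g)
            - 2 * T $ e * (2 * r2 * ((Wt y $ a - T $ a) * \<nu> $ g) - r1 * D a g)) * Wc a e)"
    unfolding sum_distrib_left
    by (subst (3) sum.swap, unfold sum_subtractf[symmetric], intro sum.cong[OF refl])
      (simp add: cov_coeff_def cov algebra_simps)
  then show ?thesis
    unfolding s1 s2 s3 s4 s5 N Hl_minus_Blow tau_coeff_def[symmetric]
    by (simp add: right_diff_distrib)
qed

end

theorem theorem2p1:
  fixes v :: volume_kind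
    and ht :: "real^'m \<Rightarrow> real^'m^'m" and Wt :: "real^'m \<Rightarrow> real^'m"
    and f :: "real^'n \<Rightarrow> real^'m"
    and Ut :: "(real^'m) set" and U :: "(real^'n) set"
  assumes "open Ut" and "open U" and "f ` U \<subseteq> Ut"
    and "\<forall>a b. smooth_on Ut (\<lambda>y. ht y $ a $ b)"
    and "\<forall>y\<in>Ut. transpose (ht y) = ht y"
    and "\<forall>y\<in>Ut. \<forall>u. u \<noteq> 0 \<longrightarrow> u \<bullet> (ht y *v u) > 0"
    and "\<forall>a. smooth_on Ut (\<lambda>y. Wt y $ a)"
    and "\<forall>y\<in>Ut. normWt2 ht Wt y < 1"
    and "\<forall>a. smooth_on U (\<lambda>x. f x $ a)"
    and "\<forall>x\<in>U. rank (jac f x) = CARD('n)"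
  shows "\<forall>x\<in>U. \<forall>g. mean_curv v ht Wt f x g = H_formula v ht Wt f x g"
proof (intro ballI allI)
  fix x g assume x: "x \<in> U"
  have diff: "g differentiable_on X" if "smooth_on X g" for X :: "(real^'k) set" and g
    using that[unfolded smooth_on_def, rule_format, of 1] by simp
  interpret navigation ht Wt Ut
    by unfold_locales (use assms in \<open>auto intro: diff\<close>)
  have fx: "f x \<in> Ut" using assms(3) x by blast
  interpret navigation_point ht Wt Ut v "f x" "jac f x"
    by unfold_locales (use fx det_gram[OF fx] assms(10) x in auto)
  have "pd (pd (\<lambda>y. f y $ e) j) i x = pd (pd (\<lambda>y. f y $ e) i) j x" for e i j
    by (rule pd_commute[OF assms(2) x]) (use assms(9) in \<open>simp add: smooth_on_def\<close>)
  \<comment> \<open>The second derivatives of the immersion are symmetric by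
    \<open>pd_commute\<close>, and the arbitrary \<open>\<Gamma>\<close> becomes the induced
    Christoffel symbols, so that \<open>sff\<close> appears.\<close>
  note el = euler_lagrange_volF[where Hess = "\<lambda>e i j. pd (pd (\<lambda>y. f y $ e) j) i x", OF this,
      of g "GM ht f x"]
  show "mean_curv v ht Wt f x g = H_formula v ht Wt f x g"
    unfolding mean_curv_def H_formula_def Let_def el sfun_eq_nav_s normWt2_eq
    unfolding log_chi_at_def[of v "ht (f x)" "Wt (f x)" "jac f x", symmetric] formula_coeffs sff_def ..
qed

end
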